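(* Let $n$ be a positive integer. The set of fixed-point forms of $\mathrm{PSSPM}(n)$ (the parallel symmetric sandpile model started from a single column of $n$ grains) is equal to the set of fixed-point forms of $\mathrm{SSPM}(n)$ (the sequential symmetric sandpile model started from a single column of $n$ grains). Consequently, there are exactly $\lfloor\sqrt{n}\rfloor$ fixed-point forms of $\mathrm{PSSPM}(n)$.
   Context: A configuration assigns to each position $i\in\mathbb{Z}$ a height $a_i\in\mathbb{Z}_{\ge 0}$ (number of grains in column $i$), with only finitely many nonzero heights. The initial configuration $(n)$ has $n$ grains in one column (position $0$) and height $0$ elsewhere. Column $i$ is right collapsible if $a_i-a_{i+1}\ge 2$; collapsing on the right moves one grain from column $i$ to column $i+1$. Column $i$ is left collapsible if $a_i-a_{i-1}\ge 2$; collapsing on the left moves one grain from column $i$ to column $i-1$. A column is collapsible if it is right or left collapsible. $\mathrm{SSPM}$ rule: at each step exactly one collapsible column collapses once, in a direction in which it is collapsible. $\mathrm{PSSPM}$ rule: at each step all columns that are collapsible in the current configuration collapse simultaneously, each exactly once; a column collapsible on both sides collapses in exactly one of the two directions (chosen freely), and a column collapsible on only one side collapses on that side. $\mathrm{SSPM}(n)$ (resp. $\mathrm{PSSPM}(n)$) is the set of all configurations reachable from $(n)$ by finitely many (possibly zero) steps of the $\mathrm{SSPM}$ (resp. $\mathrm{PSSPM}$) rule. A fixed point is a reachable configuration having no collapsible column. The form of a configuration is its finite sequence of nonzero heights read from left to right, i.e. the configuration up to translation (mirror images are not identified). A fixed-point form is the form of a fixed point. *)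

theory Defs
  imports Complex_Main
begin

text \<open>Finiteness of the support is not built into the type: it holds for the initial
  configuration and is preserved by both collapsing rules.\<close>

type_synonym config = "int \<Rightarrow> nat"

definition initial :: "nat \<Rightarrow> config" where
  "initial n = (\<lambda>i. if i = 0 then n else 0)"

definition right_collapsible :: "config \<Rightarrow> int \<Rightarrow> bool" where
  "right_collapsible a i \<longleftrightarrow> int (a i) - int (a (i + 1)) \<ge> 2"

definition left_collapsible :: "config \<Rightarrow> int \<Rightarrow> bool" where
  "left_collapsible a i \<longleftrightarrow> int (a i) - int (a (i - 1)) \<ge> 2"

definition collapsible :: "config \<Rightarrow> int \<Rightarrow> bool" where
  "collapsible a i \<longleftrightarrow> right_collapsible a i \<or> left_collapsible a i"

definition move_grain :: "int \<Rightarrow> int \<Rightarrow> config \<Rightarrow> config" where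
  "move_grain i j a = a(i := a i - 1, j := a j + 1)"

definition sspm_step :: "config \<Rightarrow> config \<Rightarrow> bool" where
  "sspm_step a b \<longleftrightarrow>
     (\<exists>i. right_collapsible a i \<and> b = move_grain i (i + 1) a
        \<or> left_collapsible a i \<and> b = move_grain i (i - 1) a)"

text \<open>\<open>R\<close> and \<open>L\<close> are the sets of columns that collapse on the right and on the left.
  The truncated subtraction is harmless, since a collapsible column has at least two grains.
  If no column is collapsible, the only possible step is the idle one.\<close>

definition psspm_step :: "config \<Rightarrow> config \<Rightarrow> bool" where
  "psspm_step a b \<longleftrightarrow>
     (\<exists>R L. R \<union> L = {i. collapsible a i} \<and> R \<inter> L = {}
        \<and> (\<forall>i\<in>R. right_collapsible a i) \<and> (\<forall>i\<in>L. left_collapsible a i)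
        \<and> b = (\<lambda>i. a i - of_bool (i \<in> R \<union> L) + of_bool (i - 1 \<in> R) + of_bool (i + 1 \<in> L)))"

definition SSPM :: "nat \<Rightarrow> config set" where
  "SSPM n = {a. sspm_step\<^sup>*\<^sup>* (initial n) a}"

definition PSSPM :: "nat \<Rightarrow> config set" where
  "PSSPM n = {a. psspm_step\<^sup>*\<^sup>* (initial n) a}"

text \<open>Reachable configurations have an interval as support, so the list of nonzero heights
  determines them up to translation.\<close>

definition form :: "config \<Rightarrow> nat list" where
  "form a = map a (sorted_list_of_set {i. a i \<noteq> 0})"

definition fixed_points :: "config set \<Rightarrow> config set" where
  "fixed_points S = {a \<in> S. \<forall>i. \<not> collapsible a i}"

definition fixed_point_forms :: "config set \<Rightarrow> nat list set" where
  "fixed_point_forms S = form ` fixed_points S"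

end

theory Submission
  imports Defs
begin

text \<open>
  Let \<open>S\<^sub>i\<close> be the number of grains in the columns \<open>\<le> i\<close>, let \<open>h = \<lfloor>sqrt n\<rfloor>\<close> and let \<open>T\<close> be the
  \<open>(h - 1)\<close>-st triangular number. Reachable configurations split at some column into two one-sided
  sandpiles, and on each side a stable one is a staircase with at most one repeated step, so a fixed
  point can be cut so that \<open>T + x\<close> grains with \<open>x < h\<close> lie on the left; the form depends only on
  \<open>x\<close>, and distinct \<open>x\<close> give distinct forms.

  Every parallel step of a two-sided pile decomposes into sequential steps, so it remains to reach
  every \<open>x\<close> in parallel. The parallel rule is attractive: two configurations whose partial sums
  satisfy \<open>0 \<le> S\<^sub>i(a) - S\<^sub>i(b) \<le> 1\<close> can be run so that this persists. Two choices at the same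
  peak are related in this way, so for fixed \<open>i\<close> the values \<open>S\<^sub>i(f)\<close> over the reachable fixed points
  \<open>f\<close> form an interval. Collapsing on the right whenever possible gives a fixed point \<open>f\<close> with
  \<open>S\<^sub>i(f) + S\<^sub>-\<^sub>i(f) \<le> n + 1\<close> for all \<open>i\<close>: the first moves all go to the right until column 1 has
  caught up with column 0, and then attractiveness, applied to \<open>f\<close> and its mirror image, preserves
  the bound. The intervals spanned by \<open>f\<close> and its mirror image therefore cover all of
  \<open>1, \<dots>, n\<close>, so every number in this range, in particular \<open>T + 1, \<dots>, T + h\<close>, is a
  partial sum of a reachable fixed point. This yields every \<open>x\<close> except \<open>x = 0\<close> for \<open>n = h\<^sup>2\<close>, the
  pyramid, which is reached by keeping the pile symmetric around column 0 up to one grain.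
\<close>

section \<open>Two-sided sandpiles\<close>

text \<open>The update of \<open>psspm_step\<close> without the demand that \<open>R\<close> and
  \<open>L\<close> exhaust the collapsible columns, so that a sequential move is the case of one
  singleton and one empty set.\<close>

definition fire :: "int set \<Rightarrow> int set \<Rightarrow> config \<Rightarrow> config" where
  "fire R L a = (\<lambda>i. a i - of_bool (i \<in> R \<union> L) + of_bool (i - 1 \<in> R) + of_bool (i + 1 \<in> L))"

definition legal :: "config \<Rightarrow> int set \<Rightarrow> int set \<Rightarrow> bool" where
  "legal a R L \<longleftrightarrow> (\<forall>i\<in>R. right_collapsible a i) \<and> (\<forall>i\<in>L. left_collapsible a i) \<and> R \<inter> L = {}"

text \<open>Skipping empty columns keeps the index set finite for finite support; a library sum over
  an infinite set would be 0.\<close>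

definition cum :: "config \<Rightarrow> int \<Rightarrow> int" where
  "cum a i = (\<Sum>j | j \<le> i \<and> a j \<noteq> 0. int (a j))"

definition mirror :: "config \<Rightarrow> config" where
  "mirror a = (\<lambda>i. a (- i))"

definition stable_config :: "config \<Rightarrow> bool" where
  "stable_config a \<longleftrightarrow> (\<forall>i. \<not> collapsible a i)"

text \<open>For positive heights the partial sums of (drop minus 1) are at least \<open>-1\<close>: this is the
  reachability condition of the one-sided model, where between two plateaus there is a cliff.\<close>
definition descends :: "config \<Rightarrow> int \<Rightarrow> bool" where
  "descends a c \<longleftrightarrow> (\<forall>i j. c \<le> i \<longrightarrow> i < j \<longrightarrow> a j > 0 \<longrightarrow> int (a j) + (j - i) \<le> int (a i) + 1)"

text \<open>Column \<open>c\<close> starts the right pile and column \<open>c - 1\<close> the left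
  one: reflection sends the columns \<open>\<le> c - 1\<close> to those
  \<open>\<ge> 1 - c\<close>.\<close>

definition twosided :: "config \<Rightarrow> int \<Rightarrow> bool" where
  "twosided a c \<longleftrightarrow> descends a c \<and> descends (mirror a) (1 - c)"

text \<open>The invariant of all runs. The total is expressed through \<open>cum\<close>, so that
  later arguments can speak of partial sums only.\<close>

definition sandpile :: "nat \<Rightarrow> config \<Rightarrow> bool" where
  "sandpile n a \<longleftrightarrow> finite {i. a i \<noteq> 0} \<and> (\<exists>m. \<forall>i\<ge>m. cum a i = int n) \<and> (\<exists>c. twosided a c)"

lemma psspm_step_iff:
  "psspm_step a b \<longleftrightarrow> (\<exists>R L. legal a R L \<and> R \<union> L = {i. collapsible a i} \<and> b = fire R L a)"
  unfolding psspm_step_def legal_def fire_def by blast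

lemma psspm_stepI:
  "legal a R L \<Longrightarrow> R \<union> L = {i. collapsible a i} \<Longrightarrow> psspm_step a (fire R L a)"
  unfolding psspm_step_iff by blast

section \<open>Reflection symmetry\<close>

lemma mirror_mirror [simp]: "mirror (mirror a) = a"
  by (simp add: mirror_def)

lemma right_collapsible_mirror: "right_collapsible (mirror a) i \<longleftrightarrow> left_collapsible a (- i)"
  by (simp add: right_collapsible_def left_collapsible_def mirror_def)

lemma left_collapsible_mirror: "left_collapsible (mirror a) i \<longleftrightarrow> right_collapsible a (- i)"
  by (simp add: right_collapsible_def left_collapsible_def mirror_def)

lemma collapsible_mirror: "collapsible (mirror a) i \<longleftrightarrow> collapsible a (- i)"
  by (auto simp: collapsible_def right_collapsible_mirror left_collapsible_mirror)

lemma stable_mirror [simp]: "stable_config (mirror a) \<longleftrightarrow> stable_config a"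
  by (metis add.inverse_inverse collapsible_mirror stable_config_def)

lemma fire_mirror: "fire (uminus ` L) (uminus ` R) (mirror a) = mirror (fire R L a)"
proof -
  have *: "i \<in> uminus ` X \<longleftrightarrow> - i \<in> X" for i and X :: "int set"
    by (metis add.inverse_inverse imageE image_eqI)
  show ?thesis
    by (rule ext) (auto simp: fire_def mirror_def * algebra_simps)
qed

lemma legal_mirror: "legal (mirror a) (uminus ` L) (uminus ` R) \<longleftrightarrow> legal a R L"
  by (auto simp: legal_def right_collapsible_mirror left_collapsible_mirror)

lemma psspm_step_mirror:
  assumes "psspm_step a b" shows "psspm_step (mirror a) (mirror b)"
proof -
  obtain R L where RL: "legal a R L" "R \<union> L = {i. collapsible a i}" "b = fire R L a"
    using assms unfolding psspm_step_iff by blast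
  have "uminus ` L \<union> uminus ` R = uminus ` {i. collapsible a i}"
    unfolding RL(2)[symmetric] by blast
  also have "\<dots> = {i. collapsible (mirror a) i}"
    by (auto simp: collapsible_mirror intro!: image_eqI[where x = "- x" for x])
  finally show ?thesis
    unfolding psspm_step_iff RL(3) fire_mirror[symmetric]
    using RL(1) legal_mirror by blast
qed

lemma psspm_steps_mirror:
  "psspm_step\<^sup>*\<^sup>* a b \<Longrightarrow> psspm_step\<^sup>*\<^sup>* (mirror a) (mirror b)"
  by (induction rule: rtranclp_induct) (auto intro: psspm_step_mirror rtranclp.rtrancl_into_rtrancl)

lemma mirror_initial [simp]: "mirror (initial n) = initial n"
  by (auto simp: mirror_def initial_def)

lemma finite_supp_mirror: "finite {i. mirror a i \<noteq> 0} \<longleftrightarrow> finite {i. a i \<noteq> 0}"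
proof -
  have "{i. mirror a i \<noteq> 0} = uminus ` {i. a i \<noteq> 0}"
    by (auto simp: mirror_def intro!: image_eqI[where x = "- x" for x])
  then show ?thesis
    by (simp add: finite_image_iff)
qed

lemma finite_int_bounds:
  fixes X :: "int set" assumes "finite X"
  shows "\<exists>m M. \<forall>i\<in>X. m \<le> i \<and> i \<le> M"
  using assms by (intro exI[of _ "Min X"] exI[of _ "Max X"]) auto

section \<open>Partial sums under collapses and reflection\<close>

lemma cum_rec:
  assumes "finite {i. a i \<noteq> 0}" shows "cum a i = cum a (i - 1) + int (a i)"
proof -
  have "cum a i = sum (\<lambda>j. int (a j)) ({j. j \<le> i - 1 \<and> a j \<noteq> 0} \<union> (if a i = 0 then {} else {i}))"
    unfolding cum_def by (rule sum.cong) (auto split: if_splits simp: order_le_less zle_diff1_eq)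
  also have "\<dots> = cum a (i - 1) + sum (\<lambda>j. int (a j)) (if a i = 0 then {} else {i})"
    unfolding cum_def by (rule sum.union_disjoint) (use assms in \<open>auto split: if_splits intro: finite_subset[OF _ assms]\<close>)
  finally show ?thesis by (simp split: if_splits)
qed

lemma cum_eq_0:
  assumes "finite {i. a i \<noteq> 0}" obtains m where "\<And>i. i \<le> m \<Longrightarrow> cum a i = 0"
proof -
  obtain m M where m: "\<And>i. i \<in> {i. a i \<noteq> 0} \<Longrightarrow> m \<le> i \<and> i \<le> M"
    using finite_int_bounds[OF assms] by blast
  have "cum a i = 0" if "i \<le> m - 1" for i
  proof -
    have "{j. j \<le> i \<and> a j \<noteq> 0} = {}" using m that by force
    then show ?thesis unfolding cum_def by (metis sum.empty)
  qed
  then show ?thesis using that by blast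
qed

lemma cum_unique:
  assumes fin: "finite {i. a i \<noteq> 0}" and rec: "\<And>i. F i = F (i - 1) + int (a i)"
    and low: "\<And>i. i \<le> m \<Longrightarrow> F i = 0"
  shows "cum a i = F i"
proof -
  obtain m' where m': "\<And>i. i \<le> m' \<Longrightarrow> cum a i = 0"
    using cum_eq_0[OF fin] by blast
  show ?thesis
  proof (cases "i \<le> min m m'")
    case True then show ?thesis using low m' by simp
  next
    case False
    then have "min m m' \<le> i" by linarith
    then show ?thesis
    proof (induction i rule: int_ge_induct)
      case base then show ?case using low m' by simp
    next
      case (step i)
      then show ?case using rec[of "i + 1"] cum_rec[OF fin, of "i + 1"] by simp
    qed
  qed
qed

lemma cum_mono:
  assumes "finite {i. a i \<noteq> 0}" "i \<le> j" shows "cum a i \<le> cum a j"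
  using assms(2)
proof (induction j rule: int_ge_induct)
  case (step j) then show ?case using cum_rec[OF assms(1), of "j + 1"] by simp
qed simp

lemma legal_supp:
  assumes "legal a R L" shows "R \<union> L \<subseteq> {i. a i \<noteq> 0}"
  using assms by (auto simp: legal_def right_collapsible_def left_collapsible_def)

lemma finite_supp_fire:
  assumes "finite {i. a i \<noteq> 0}" "legal a R L"
  shows "finite {i. fire R L a i \<noteq> 0}"
proof (rule finite_subset)
  show "{i. fire R L a i \<noteq> 0} \<subseteq> {i. a i \<noteq> 0} \<union> (\<lambda>i. i + 1) ` R \<union> (\<lambda>i. i - 1) ` L"
  proof
    fix i assume "i \<in> {i. fire R L a i \<noteq> 0}"
    then have "a i \<noteq> 0 \<or> i - 1 \<in> R \<or> i + 1 \<in> L"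
      by (auto simp: fire_def)
    then show "i \<in> {i. a i \<noteq> 0} \<union> (\<lambda>i. i + 1) ` R \<union> (\<lambda>i. i - 1) ` L"
      by (force intro: image_eqI[of _ _ "i - 1"] image_eqI[of _ _ "i + 1"])
  qed
  show "finite ({i. a i \<noteq> 0} \<union> (\<lambda>i. i + 1) ` R \<union> (\<lambda>i. i - 1) ` L)"
    using assms legal_supp[OF assms(2)] finite_subset[OF _ assms(1)] by auto
qed

lemma int_fire:
  assumes "legal a R L"
  shows "int (fire R L a i) = int (a i) - of_bool (i \<in> R) - of_bool (i \<in> L)
           + of_bool (i - 1 \<in> R) + of_bool (i + 1 \<in> L)"
  using assms by (auto simp: legal_def fire_def of_bool_def right_collapsible_def left_collapsible_def)

text \<open>Only a right collapse of column \<open>i\<close> and a left collapse of column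
  \<open>i + 1\<close> carry a grain across the edge between these two columns.\<close>

lemma cum_fire:
  assumes "finite {i. a i \<noteq> 0}" "legal a R L"
  shows "cum (fire R L a) i = cum a i - of_bool (i \<in> R) + of_bool (i + 1 \<in> L)"
proof -
  obtain m where m: "\<And>i. i \<le> m \<Longrightarrow> cum a i = 0"
    using cum_eq_0[OF assms(1)] by blast
  have "finite (R \<union> L)"
    using legal_supp[OF assms(2)] finite_subset[OF _ assms(1)] by blast
  then obtain l u where l: "\<And>i. i \<in> R \<union> L \<Longrightarrow> l \<le> i \<and> i \<le> u"
    using finite_int_bounds by meson
  show ?thesis
  proof (rule cum_unique[OF finite_supp_fire[OF assms]])
    show "cum a i - of_bool (i \<in> R) + of_bool (i + 1 \<in> L) =
        cum a (i - 1) - of_bool (i - 1 \<in> R) + of_bool (i - 1 + 1 \<in> L) + int (fire R L a i)" for i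
      unfolding int_fire[OF assms(2)] using cum_rec[OF assms(1), of i] by (simp add: algebra_simps)
    show "cum a i - of_bool (i \<in> R) + of_bool (i + 1 \<in> L) = 0" if "i \<le> min m (l - 2)" for i
    proof -
      have "i \<notin> R" "i + 1 \<notin> L" using l[of i] l[of "i + 1"] that by force+
      then show ?thesis using m[of i] that by simp
    qed
  qed
qed

lemma total_fire:
  assumes "finite {i. a i \<noteq> 0}" "legal a R L" "\<exists>m. \<forall>i\<ge>m. cum a i = int n"
  shows "\<exists>m. \<forall>i\<ge>m. cum (fire R L a) i = int n"
proof -
  obtain m where m: "\<And>i. i \<ge> m \<Longrightarrow> cum a i = int n"
    using assms(3) by blast
  have "finite (R \<union> L)"
    using legal_supp[OF assms(2)] finite_subset[OF _ assms(1)] by blast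
  then obtain l u where l: "\<And>i. i \<in> R \<union> L \<Longrightarrow> l \<le> i \<and> i \<le> u"
    using finite_int_bounds by meson
  have "cum (fire R L a) i = int n" if "i \<ge> max m (u + 1)" for i
  proof -
    have "i \<notin> R" "i + 1 \<notin> L" using l[of i] l[of "i + 1"] that by force+
    then show ?thesis unfolding cum_fire[OF assms(1,2)] using m[of i] that by simp
  qed
  then show ?thesis by blast
qed

lemma cum_mirror:
  assumes fin: "finite {i. a i \<noteq> 0}" and tot: "\<exists>m. \<forall>i\<ge>m. cum a i = int n"
  shows "cum (mirror a) i = int n - cum a (- i - 1)"
proof -
  obtain m where m: "\<And>i. i \<ge> m \<Longrightarrow> cum a i = int n"
    using tot by blast
  show ?thesis
  proof (rule cum_unique)
    show "finite {i. mirror a i \<noteq> 0}" using fin finite_supp_mirror by blast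
    show "int n - cum a (- i - 1) = int n - cum a (- (i - 1) - 1) + int (mirror a i)" for i
      using cum_rec[OF fin, of "- i"] by (simp add: mirror_def)
    show "int n - cum a (- i - 1) = 0" if "i \<le> - m - 1" for i
      using m[of "- i - 1"] that by simp
  qed
qed

lemma total_mirror:
  assumes fin: "finite {i. a i \<noteq> 0}" and tot: "\<exists>m. \<forall>i\<ge>m. cum a i = int n"
  shows "\<exists>m. \<forall>i\<ge>m. cum (mirror a) i = int n"
proof -
  obtain m where m: "\<And>i. i \<le> m \<Longrightarrow> cum a i = 0"
    using cum_eq_0[OF fin] by blast
  have "cum (mirror a) i = int n" if "i \<ge> - m" for i
    unfolding cum_mirror[OF assms] using m[of "- i - 1"] that by simp
  then show ?thesis by blast
qed

lemma cum_le_total: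
  assumes fin: "finite {i. a i \<noteq> 0}" and tot: "\<exists>m. \<forall>i\<ge>m. cum a i = int n"
  shows "cum a i \<le> int n"
proof -
  obtain m where m: "\<And>i. i \<ge> m \<Longrightarrow> cum a i = int n"
    using tot by blast
  have "cum a i \<le> cum a (max i m)" by (rule cum_mono[OF fin]) simp
  with m[of "max i m"] show ?thesis by simp
qed

section \<open>Invariance of the two-sided shape\<close>

lemma sandpile_mirror: "sandpile n a \<Longrightarrow> sandpile n (mirror a)"
proof -
  assume a: "sandpile n a"
  then obtain c where "twosided a c" by (auto simp: sandpile_def)
  then have "twosided (mirror a) (1 - c)" by (simp add: twosided_def)
  with a show ?thesis unfolding sandpile_def using total_mirror finite_supp_mirror by blast
qed

lemma sandpile_initial: "sandpile n (initial n)"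
proof -
  have fin: "finite {i. initial n i \<noteq> 0}"
    by (rule finite_subset[of _ "{0}"]) (auto simp: initial_def)
  have "cum (initial n) i = int n" if "i \<ge> 0" for i
  proof -
    have "cum (initial n) i = (if 0 \<le> i then int n else 0)"
      by (rule cum_unique[OF fin, of _ "-1"]) (auto simp: initial_def)
    then show ?thesis using that by simp
  qed
  moreover have "twosided (initial n) 0"
    by (auto simp: twosided_def descends_def mirror_def initial_def)
  ultimately show ?thesis unfolding sandpile_def using fin by blast
qed

text \<open>A move at \<open>i \<ge> c\<close> stays in the right pile and keeps the cut. At
  \<open>i = c - 1\<close> the column joins the right pile and the cut moves to
  \<open>c - 1\<close>. Further left the heights do not fall to the right, so no such move
  exists.\<close>

lemma twosided_move_right:
  assumes "twosided a c" "right_collapsible a i"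
  shows "\<exists>c'. twosided (move_grain i (i + 1) a) c'"
proof -
  let ?b = "move_grain i (i + 1) a"
  have D: "int (a l) + (l - k) \<le> int (a k) + 1" if "c \<le> k" "k < l" "a l > 0" for k l
    using assms(1) that by (auto simp: twosided_def descends_def)
  have A: "int (a l) + (k - l) \<le> int (a k) + 1" if "l < k" "k < c" "a l > 0" for k l
  proof -
    have "\<And>x y. 1 - c \<le> x \<Longrightarrow> x < y \<Longrightarrow> a (- y) > 0 \<Longrightarrow> int (a (- y)) + (y - x) \<le> int (a (- x)) + 1"
      using assms(1) unfolding twosided_def descends_def mirror_def by blast
    from this[of "- k" "- l"] that show ?thesis by simp
  qed
  have tsI: "twosided ?b d" if "\<And>k l. d \<le> k \<Longrightarrow> k < l \<Longrightarrow> ?b l > 0 \<Longrightarrow> int (?b l) + (l - k) \<le> int (?b k) + 1"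
    "\<And>k l. l < k \<Longrightarrow> k < d \<Longrightarrow> ?b l > 0 \<Longrightarrow> int (?b l) + (k - l) \<le> int (?b k) + 1" for d
    unfolding twosided_def descends_def
  proof (intro conjI allI impI)
    show "int (mirror ?b j) + (j - k) \<le> int (mirror ?b k) + 1"
      if "1 - d \<le> k" "k < j" "0 < mirror ?b j" for k j
      using \<open>\<And>k l. l < k \<Longrightarrow> k < d \<Longrightarrow> ?b l > 0 \<Longrightarrow> int (?b l) + (k - l) \<le> int (?b k) + 1\<close>[of "-j" "-k"] that
      by (simp add: mirror_def)
  qed (use that(1) in blast)
  have rc: "int (a i) \<ge> int (a (i + 1)) + 2" using assms(2) by (simp add: right_collapsible_def)
  have b: "int (?b i) = int (a i) - 1" "?b (i + 1) = a (i + 1) + 1" "j \<noteq> i \<Longrightarrow> j \<noteq> i + 1 \<Longrightarrow> ?b j = a j" for j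
    using rc by (auto simp: move_grain_def)
  \<comment> \<open>Both remaining cases at once: \<open>min c i\<close> is the cut after the
    move.\<close>
  have desc: "int (?b l) + (l - k) \<le> int (?b k) + 1"
    if kl: "min c i \<le> k" "c - 1 \<le> i" "k < l" "?b l > 0" for k l
  proof -
    have kc: "k \<noteq> i \<Longrightarrow> c \<le> k" "c \<le> i + 1" using kl by linarith+
    consider "l = i" | "l = i + 1" "k = i" | "l = i + 1" "k < i" | "l \<noteq> i" "l \<noteq> i + 1" by (use kl in force)
    then show ?thesis
    proof cases
      case 1 then show ?thesis using D[of k i] b(1) b(3)[of k] kl kc rc by auto
    next
      case 2 then show ?thesis using b rc by auto
    next
      case 3 then show ?thesis using D[of k i] b(2) b(3)[of k] kl kc rc by auto
    next
      case 4
      then have l: "a l > 0" "?b l = a l" using b(3)[of l] kl by auto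
      show ?thesis
      proof (cases "k = i")
        case True
        \<comment> \<open>The cliff of at least 2 at \<open>i\<close> pays for the lost grain and
          for using the bound from \<open>i + 1\<close> instead of \<open>i\<close>.\<close>
        then show ?thesis using D[of "i + 1" l] b(1) l rc kl kc 4 by auto
      next
        case False
        then show ?thesis using D[of k l] l b(2) b(3)[of k] kl kc by (cases "k = i + 1") auto
      qed
    qed
  qed
  consider "i \<ge> c" | "i = c - 1" | "i < c - 1" by linarith
  then show ?thesis
  proof cases
    case 1
    have "twosided ?b c"
    proof (rule tsI)
      show "int (?b l) + (k - l) \<le> int (?b k) + 1" if "l < k" "k < c" "?b l > 0" for k l
        using A[of l k] b(3)[of l] b(3)[of k] that 1 by simp
    qed (use desc 1 in simp)
    then show ?thesis ..
  next
    case 2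
    have "twosided ?b (c - 1)"
    proof (rule tsI)
      show "int (?b l) + (k - l) \<le> int (?b k) + 1" if "l < k" "k < c - 1" "?b l > 0" for k l
        using A[of l k] b(3)[of l] b(3)[of k] that 2 by simp
    qed (use desc 2 in simp)
    then show ?thesis ..
  next
    case 3
    then have False using A[of i "i + 1"] rc by simp
    then show ?thesis ..
  qed
qed

lemma move_grain_right: "move_grain i (i + 1) a = fire {i} {} a"
  by (rule ext) (auto simp: move_grain_def fire_def)

lemma move_grain_left: "move_grain i (i - 1) a = fire {} {i} a"
  by (rule ext) (auto simp: move_grain_def fire_def)

lemma sspm_step_iff:
  "sspm_step a b \<longleftrightarrow> (\<exists>i. right_collapsible a i \<and> b = fire {i} {} a \<or> left_collapsible a i \<and> b = fire {} {i} a)"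
  by (simp add: sspm_step_def move_grain_right move_grain_left)

lemma sandpile_sspm_step:
  assumes "sandpile n a" "sspm_step a b" shows "sandpile n b"
proof -
  from assms(1) obtain c where a: "finite {i. a i \<noteq> 0}" "\<exists>m. \<forall>i\<ge>m. cum a i = int n" "twosided a c"
    by (auto simp: sandpile_def)
  from assms(2) obtain i where "right_collapsible a i \<and> b = fire {i} {} a \<or> left_collapsible a i \<and> b = fire {} {i} a"
    unfolding sspm_step_iff by blast
  then show ?thesis
  proof (elim disjE conjE)
    assume i: "right_collapsible a i" "b = fire {i} {} a"
    then have "legal a {i} {}" by (simp add: legal_def)
    moreover have "\<exists>c. twosided b c"
      using twosided_move_right[OF a(3) i(1)] i(2) move_grain_right by simp
    ultimately show ?thesis
      unfolding sandpile_def i(2) using finite_supp_fire[OF a(1)] total_fire[OF a(1) _ a(2)] by blast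
  next
    assume i: "left_collapsible a i" "b = fire {} {i} a"
    then have "legal a {} {i}" by (simp add: legal_def)
    moreover have "\<exists>c. twosided b c"
    proof -
      have "twosided (mirror a) (1 - c)" using a(3) by (simp add: twosided_def)
      moreover have "right_collapsible (mirror a) (- i)" using i(1) by (simp add: right_collapsible_mirror)
      ultimately obtain d where "twosided (fire {- i} {} (mirror a)) d"
        using twosided_move_right move_grain_right by metis
      then have "twosided (mirror b) d" using fire_mirror[of "{i}" "{}" a] i(2) by simp
      then have "twosided b (1 - d)" by (simp add: twosided_def)
      then show ?thesis ..
    qed
    ultimately show ?thesis
      unfolding sandpile_def i(2) using finite_supp_fire[OF a(1)] total_fire[OF a(1) _ a(2)] by blast
  qed
qed

lemma sandpile_sspm_steps: "sspm_step\<^sup>*\<^sup>* a b \<Longrightarrow> sandpile n a \<Longrightarrow> sandpile n b"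
  by (induction rule: rtranclp_induct) (auto intro: sandpile_sspm_step)

section \<open>Energy and termination\<close>

definition energy :: "config \<Rightarrow> nat" where
  "energy a = (\<Sum>i | a i \<noteq> 0. (a i)\<^sup>2)"

lemma energy_superset:
  assumes "finite W" "{i. a i \<noteq> 0} \<subseteq> W" shows "energy a = (\<Sum>i\<in>W. (a i)\<^sup>2)"
  unfolding energy_def by (rule sum.mono_neutral_left) (use assms in auto)

text \<open>Moving a grain from height \<open>x\<close> to height \<open>y \<le> x - 2\<close>
  changes the sum of squares by \<open>2 * (y - x + 1) < 0\<close>; this makes \<open>energy\<close>
  the induction measure for runs.\<close>

lemma energy_move_grain:
  assumes "finite {i. a i \<noteq> 0}" "int (a i) \<ge> int (a j) + 2"
  shows "energy (move_grain i j a) < energy a"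
proof -
  let ?b = "move_grain i j a"
  \<comment> \<open>Column \<open>j\<close> may be empty before the move and column \<open>i\<close>
    is not assumed to stay occupied, so both sums run over one common finite set.\<close>
  define W where "W = {i. a i \<noteq> 0} \<union> {i, j}"
  have W: "finite W" "i \<in> W" "j \<in> W - {i}" using assms by (auto simp: W_def)
  have s: "(\<Sum>k\<in>W. (f k)\<^sup>2) = (f i)\<^sup>2 + ((f j)\<^sup>2 + (\<Sum>k\<in>W - {i} - {j}. (f k)\<^sup>2))" for f :: config
    using W by (metis (no_types, lifting) finite_Diff sum.remove)
  have "energy a = (a i)\<^sup>2 + ((a j)\<^sup>2 + (\<Sum>k\<in>W - {i} - {j}. (a k)\<^sup>2))"
    unfolding s[symmetric] by (rule energy_superset) (use W in \<open>auto simp: W_def\<close>)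
  moreover have "energy ?b = (?b i)\<^sup>2 + ((?b j)\<^sup>2 + (\<Sum>k\<in>W - {i} - {j}. (?b k)\<^sup>2))"
    unfolding s[symmetric] by (rule energy_superset) (use W in \<open>auto simp: W_def move_grain_def split: if_splits\<close>)
  moreover have "(\<Sum>k\<in>W - {i} - {j}. (?b k)\<^sup>2) = (\<Sum>k\<in>W - {i} - {j}. (a k)\<^sup>2)"
    by (rule sum.cong) (auto simp: move_grain_def)
  moreover have "(?b i)\<^sup>2 + (?b j)\<^sup>2 < (a i)\<^sup>2 + (a j)\<^sup>2"
  proof -
    obtain x where x: "a i = a j + 2 + x" using assms(2) by (metis le_iff_add of_nat_add of_nat_le_iff of_nat_numeral)
    have "?b i = a j + 1 + x" "?b j = a j + 1" using x W(3) by (auto simp: move_grain_def)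
    then show ?thesis unfolding x by (simp add: power2_eq_square algebra_simps)
  qed
  ultimately show ?thesis by linarith
qed

lemma energy_sspm_step:
  assumes "finite {i. a i \<noteq> 0}" "sspm_step a b" shows "energy b < energy a"
  using assms(2) energy_move_grain[OF assms(1)]
  by (auto simp: sspm_step_def right_collapsible_def left_collapsible_def)

lemma energy_sspm_steps:
  assumes "sspm_step\<^sup>*\<^sup>* a b" "sandpile n a" shows "energy b < energy a \<or> b = a"
  using assms
proof (induction rule: rtranclp_induct)
  case (step y z)
  then have "sandpile n y" using sandpile_sspm_steps by blast
  then have "energy z < energy y" using energy_sspm_step step by (auto simp: sandpile_def)
  with step show ?case by auto
qed simp

section \<open>Parallel steps as sequences of sequential moves\<close>

text \<open>The columns collapse from the rightmost to the leftmost: when \<open>m\<close> has its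
  turn, its own height is unchanged and column \<open>m + 1\<close> can only have lost a grain, so
  the cliff persists.\<close>

lemma sspm_steps_fire_right:
  assumes "finite R" "\<forall>i\<in>R. right_collapsible a i"
  shows "sspm_step\<^sup>*\<^sup>* a (fire R {} a)"
  using assms
proof (induction R rule: finite_linorder_min_induct)
  case empty
  have "fire {} {} a = a" by (auto simp: fire_def)
  then show ?case by simp
next
  case (insert m R)
  have m: "m \<notin> R" "m - 1 \<notin> R" using insert by force+
  have "right_collapsible (fire R {} a) m"
    using insert.prems m by (auto simp: right_collapsible_def fire_def)
  moreover have "fire (insert m R) {} a = fire {m} {} (fire R {} a)"
    using m by (intro ext) (auto simp: fire_def)
  ultimately have "sspm_step (fire R {} a) (fire (insert m R) {} a)"
    unfolding sspm_step_iff by auto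
  with insert show ?case by (auto intro: rtranclp.rtrancl_into_rtrancl)
qed

lemma sspm_step_mirror:
  assumes "sspm_step a b" shows "sspm_step (mirror a) (mirror b)"
proof -
  obtain i where "right_collapsible a i \<and> b = fire {i} {} a \<or> left_collapsible a i \<and> b = fire {} {i} a"
    using assms unfolding sspm_step_iff by blast
  then have "left_collapsible (mirror a) (- i) \<and> mirror b = fire {} {- i} (mirror a)
      \<or> right_collapsible (mirror a) (- i) \<and> mirror b = fire {- i} {} (mirror a)"
    using fire_mirror[of "{}" "{i}" a] fire_mirror[of "{i}" "{}" a]
    by (auto simp: right_collapsible_mirror left_collapsible_mirror)
  then show ?thesis unfolding sspm_step_iff by blast
qed

lemma sspm_steps_mirror: "sspm_step\<^sup>*\<^sup>* a b \<Longrightarrow> sspm_step\<^sup>*\<^sup>* (mirror a) (mirror b)"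
  by (induction rule: rtranclp_induct) (auto intro: sspm_step_mirror rtranclp.rtrancl_into_rtrancl)

lemma sspm_steps_fire_left:
  assumes "finite L" "\<forall>i\<in>L. left_collapsible a i"
  shows "sspm_step\<^sup>*\<^sup>* a (fire {} L a)"
proof -
  have "sspm_step\<^sup>*\<^sup>* (mirror a) (fire (uminus ` L) {} (mirror a))"
    using assms by (intro sspm_steps_fire_right) (auto simp: right_collapsible_mirror)
  then have "sspm_step\<^sup>*\<^sup>* (mirror a) (mirror (fire {} L a))"
    using fire_mirror[of L "{}" a] by simp
  then show ?thesis using sspm_steps_mirror by fastforce
qed

text \<open>Descent over distance 1 makes each pile weakly decreasing away from the cut, so a drop
  towards the other pile can occur only across the cut.\<close>

lemma twosided_collapsible:
  assumes "twosided a c"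
  shows "right_collapsible a i \<Longrightarrow> i \<ge> c - 1" "left_collapsible a i \<Longrightarrow> i \<le> c"
proof -
  have 1: "i \<le> c" if "twosided a c" "left_collapsible a i" for a c i
  proof (rule ccontr)
    assume "\<not> i \<le> c"
    moreover have "int (a i) + (i - (i - 1)) \<le> int (a (i - 1)) + 1" if "i > c"
      using \<open>twosided a c\<close> \<open>left_collapsible a i\<close> that
      unfolding twosided_def descends_def left_collapsible_def
      by (elim conjE allE[of _ "i - 1"] allE[of _ i]) auto
    ultimately show False using that by (simp add: left_collapsible_def)
  qed
  show "left_collapsible a i \<Longrightarrow> i \<le> c" using 1 assms by blast
  have "twosided (mirror a) (1 - c)" using assms by (simp add: twosided_def)
  then show "right_collapsible a i \<Longrightarrow> i \<ge> c - 1"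
    using 1[of "mirror a" "1 - c" "- i"] by (simp add: left_collapsible_mirror)
qed

text \<open>The higher of the columns \<open>c - 1\<close> and \<open>c\<close> serves as the peak
  \<open>p\<close>. It is the only column that may be collapsible on both sides.\<close>

lemma collapsible_separated:
  assumes "sandpile n a"
  obtains p where "\<And>i. right_collapsible a i \<Longrightarrow> p \<le> i" "\<And>i. left_collapsible a i \<Longrightarrow> i \<le> p"
proof -
  obtain c where c: "twosided a c" using assms by (auto simp: sandpile_def)
  show ?thesis
  proof (cases "a (c - 1) \<le> a c")
    case True
    then have "\<not> right_collapsible a (c - 1)" by (simp add: right_collapsible_def)
    then have "right_collapsible a i \<Longrightarrow> c \<le> i" for i
      using twosided_collapsible(1)[OF c, of i] by (cases "i = c - 1") auto
    then show ?thesis using that twosided_collapsible(2)[OF c] by blast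
  next
    case False
    then have "\<not> left_collapsible a c" by (simp add: left_collapsible_def)
    then have "left_collapsible a i \<Longrightarrow> i \<le> c - 1" for i
      using twosided_collapsible(2)[OF c, of i] by (cases "i = c") auto
    then show ?thesis using that[of "c - 1"] twosided_collapsible(1)[OF c] by blast
  qed
qed

text \<open>First all right collapses, then all left ones. The former happen at columns
  \<open>\<ge> p\<close>, the latter at columns \<open>\<le> p\<close>, so a column of
  \<open>L\<close> and its left neighbour are untouched when their turn comes.\<close>

lemma psspm_step_simulation:
  assumes "sandpile n a" "psspm_step a b" shows "sspm_step\<^sup>*\<^sup>* a b"
proof -
  obtain R L where RL: "legal a R L" "b = fire R L a"
    using assms(2) unfolding psspm_step_iff by blast
  obtain p where p: "\<And>i. right_collapsible a i \<Longrightarrow> p \<le> i" "\<And>i. left_collapsible a i \<Longrightarrow> i \<le> p"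
    using collapsible_separated[OF assms(1)] by blast
  have R: "p \<le> i" if "i \<in> R" for i using RL(1) p(1) that by (auto simp: legal_def)
  have L: "i \<le> p" if "i \<in> L" for i using RL(1) p(2) that by (auto simp: legal_def)
  have "finite (R \<union> L)"
    using assms(1) legal_supp[OF RL(1)] finite_subset by (auto simp: sandpile_def)
  have "sspm_step\<^sup>*\<^sup>* a (fire R {} a)"
    using RL(1) \<open>finite (R \<union> L)\<close> by (intro sspm_steps_fire_right) (auto simp: legal_def)
  also have "sspm_step\<^sup>*\<^sup>* (fire R {} a) (fire {} L (fire R {} a))"
  proof (intro sspm_steps_fire_left ballI)
    fix i assume i: "i \<in> L"
    then have "i \<notin> R" "i - 1 \<notin> R" "i - 2 \<notin> R" using RL(1) R[of "i-1"] R[of "i-2"] L[of i] by (auto simp: legal_def)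
    then show "left_collapsible (fire R {} a) i"
      using i RL(1) by (auto simp: legal_def fire_def left_collapsible_def)
  qed (use \<open>finite (R \<union> L)\<close> in simp)
  also have "fire {} L (fire R {} a) = b"
  proof (rule ext)
    fix i
    have "i \<in> L \<Longrightarrow> i \<notin> R \<and> i - 1 \<notin> R" using RL(1) R[of "i-1"] L[of i] by (auto simp: legal_def)
    then show "fire {} L (fire R {} a) i = b i" unfolding RL(2) by (auto simp: fire_def)
  qed
  finally show ?thesis .
qed

lemma sandpile_psspm_step: "sandpile n a \<Longrightarrow> psspm_step a b \<Longrightarrow> sandpile n b"
  using psspm_step_simulation sandpile_sspm_steps by blast

lemma sandpile_psspm_steps: "psspm_step\<^sup>*\<^sup>* a b \<Longrightarrow> sandpile n a \<Longrightarrow> sandpile n b"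
  by (induction rule: rtranclp_induct) (auto intro: sandpile_psspm_step)

lemma psspm_steps_simulation: "psspm_step\<^sup>*\<^sup>* a b \<Longrightarrow> sandpile n a \<Longrightarrow> sspm_step\<^sup>*\<^sup>* a b"
  by (induction rule: rtranclp_induct)
    (auto intro: psspm_step_simulation sandpile_psspm_steps rtranclp_trans)

text \<open>The sequential simulation might be empty, so \<open>b \<noteq> a\<close> has to be
  shown: equal partial sums would mean that grains cross some edge both ways, although only its
  higher end can collapse over it.\<close>

lemma energy_psspm_step:
  assumes "sandpile n a" "psspm_step a b" "\<not> stable_config a" shows "energy b < energy a"
proof -
  obtain R L where RL: "legal a R L" "R \<union> L = {i. collapsible a i}" "b = fire R L a"
    using assms(2) unfolding psspm_step_iff by blast
  have fin: "finite {i. a i \<noteq> 0}" using assms(1) by (simp add: sandpile_def)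
  obtain i where i: "i \<in> R \<or> i \<in> L" using assms(3) RL(2) by (auto simp: stable_config_def)
  have "b \<noteq> a"
  proof
    assume "b = a"
    then have e: "j \<in> R \<longleftrightarrow> j + 1 \<in> L" for j
      using cum_fire[OF fin RL(1), of j] RL(3) by (auto simp: of_bool_def split: if_splits)
    then have "\<exists>j. j \<in> R \<and> j + 1 \<in> L"
      using i e[of i] e[of "i - 1"] by (metis diff_add_cancel)
    then show False using RL(1) by (force simp: legal_def right_collapsible_def left_collapsible_def)
  qed
  then show ?thesis
    using energy_sspm_steps[OF psspm_step_simulation[OF assms(1,2)] assms(1)] by blast
qed

lemma psspm_step_stable: "stable_config a \<Longrightarrow> psspm_step a b \<longleftrightarrow> b = a"
  by (auto simp: psspm_step_iff stable_config_def fire_def legal_def)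

lemma psspm_steps_stable: "psspm_step\<^sup>*\<^sup>* a b \<Longrightarrow> stable_config a \<Longrightarrow> b = a"
  by (induction rule: rtranclp_induct) (auto simp: psspm_step_stable)

section \<open>Attractiveness of the parallel rule\<close>

definition coupled :: "config \<Rightarrow> config \<Rightarrow> bool" where
  "coupled a b \<longleftrightarrow> (\<forall>i. cum b i \<le> cum a i \<and> cum a i \<le> cum b i + 1)"

text \<open>Columns collapsing on the right in \<open>a\<close> when \<open>a\<close> is run alongside \<open>b\<close>: on a tie, \<open>a\<close> follows a
  forced left move of \<open>b\<close>.\<close>
definition rightward :: "config \<Rightarrow> config \<Rightarrow> int set" where
  "rightward a b = {i. right_collapsible a i \<and>
     \<not> (left_collapsible a i \<and> left_collapsible b i \<and> \<not> right_collapsible b i)}"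

definition leftward :: "config \<Rightarrow> config \<Rightarrow> int set" where
  "leftward a b = {i. left_collapsible a i} - rightward a b"

lemma legal_steered: "legal a (rightward a b) (leftward a b)"
  by (auto simp: legal_def rightward_def leftward_def)

lemma steered_all: "rightward a b \<union> leftward a b = {i. collapsible a i}"
  by (auto simp: rightward_def leftward_def collapsible_def)

lemma height_cum: "finite {i. a i \<noteq> 0} \<Longrightarrow> int (a i) = cum a i - cum a (i - 1)"
  using cum_rec[of a i] by simp

text \<open>With \<open>X = 2 * S_i - S_(i-1) - S_(i+1)\<close>, the edge right of \<open>i\<close>
  can be crossed rightwards iff \<open>X \<ge> 2\<close> and leftwards iff
  \<open>X \<le> - 2\<close>. Where the partial sums agree, \<open>X\<close> for \<open>a\<close> is
  at most \<open>X\<close> for \<open>b\<close>, and where they differ it is at least that; the gap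
  never exceeds 2. So any crossing that would break the coupling is also possible in the other
  configuration, and the tie rule makes it happen there.\<close>

lemma coupled_fire:
  assumes A: "finite {i. a i \<noteq> 0}" and B: "finite {i. b i \<noteq> 0}" and ab: "coupled a b"
  shows "coupled (fire (rightward a b) (leftward a b) a) (fire (rightward b a) (leftward b a) b)"
  unfolding coupled_def
proof
  fix i
  define u v where "u = cum a" and "v = cum b"
  have d: "v j \<le> u j \<and> u j \<le> v j + 1" for j using ab by (simp add: coupled_def u_def v_def)
  have h: "int (a j) = u j - u (j - 1)" "int (b j) = v j - v (j - 1)" for j
    using height_cum[OF A] height_cum[OF B] by (simp_all add: u_def v_def)
  have rc: "right_collapsible a j \<longleftrightarrow> 2 * u j - u (j - 1) - u (j + 1) \<ge> 2"
    "right_collapsible b j \<longleftrightarrow> 2 * v j - v (j - 1) - v (j + 1) \<ge> 2" for j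
    by (auto simp: right_collapsible_def h)
  have lc: "left_collapsible a j \<longleftrightarrow> u j + u (j - 2) - 2 * u (j - 1) \<ge> 2"
    "left_collapsible b j \<longleftrightarrow> v j + v (j - 2) - 2 * v (j - 1) \<ge> 2" for j
    by (auto simp: left_collapsible_def h)
  show "cum (fire (rightward b a) (leftward b a) b) i \<le> cum (fire (rightward a b) (leftward a b) a) i \<and>
    cum (fire (rightward a b) (leftward a b) a) i \<le> cum (fire (rightward b a) (leftward b a) b) i + 1"
    unfolding cum_fire[OF A legal_steered] cum_fire[OF B legal_steered]
    unfolding leftward_def rightward_def mem_Collect_eq Diff_iff rc lc u_def[symmetric] v_def[symmetric]
    using d[of i] d[of "i - 1"] d[of "i - 2"] d[of "i + 1"] d[of "i + 2"]
    by (simp add: of_bool_def) linarith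
qed

text \<open>Both run in lockstep. One that is already stable makes idle steps, so the summed energy
  drops until both are stable.\<close>

lemma coupled_fixed_points:
  assumes "sandpile n a" "sandpile n b" "coupled a b"
  shows "\<exists>f g. psspm_step\<^sup>*\<^sup>* a f \<and> stable_config f \<and> psspm_step\<^sup>*\<^sup>* b g \<and> stable_config g \<and> coupled f g"
  using assms
proof (induction "energy a + energy b" arbitrary: a b rule: less_induct)
  case less
  show ?case
  proof (cases "stable_config a \<and> stable_config b")
    case False
    define a' b' where "a' = fire (rightward a b) (leftward a b) a" and "b' = fire (rightward b a) (leftward b a) b"
    have step: "psspm_step a a'" "psspm_step b b'"
      unfolding a'_def b'_def using psspm_stepI[OF legal_steered steered_all] by blast+
    have e: "energy a' \<le> energy a" "energy b' \<le> energy b"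
      using energy_sspm_steps[OF psspm_step_simulation[OF less.prems(1) step(1)] less.prems(1)]
        energy_sspm_steps[OF psspm_step_simulation[OF less.prems(2) step(2)] less.prems(2)] by auto
    have "energy a' < energy a \<or> energy b' < energy b"
      using energy_psspm_step step less.prems False by blast
    then have "energy a' + energy b' < energy a + energy b" using e by linarith
    moreover have "coupled a' b'"
      unfolding a'_def b'_def using coupled_fire less.prems by (auto simp: sandpile_def)
    moreover have "sandpile n a'" "sandpile n b'"
      using sandpile_psspm_step less.prems step by blast+
    ultimately obtain f g where "psspm_step\<^sup>*\<^sup>* a' f" "stable_config f"
        "psspm_step\<^sup>*\<^sup>* b' g" "stable_config g" "coupled f g"
      using less.hyps[of a' b'] by blast
    then show ?thesis
      using converse_rtranclp_into_rtranclp[of psspm_step, OF step(1)]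
        converse_rtranclp_into_rtranclp[of psspm_step, OF step(2)] by blast
  qed (use less.prems in blast)
qed

lemma fixed_point_exists:
  assumes "sandpile n a" shows "\<exists>f. psspm_step\<^sup>*\<^sup>* a f \<and> stable_config f"
proof -
  have "coupled a a" by (simp add: coupled_def)
  then show ?thesis using coupled_fixed_points[OF assms assms] by blast
qed

text \<open>Only the peak \<open>p\<close> has a choice. Sending its grain left instead of right
  raises exactly the partial sums at \<open>p - 1\<close> and \<open>p\<close>, each by 1.\<close>

lemma coupled_successors:
  assumes a: "sandpile n a" and b: "psspm_step a b" "psspm_step a b'"
  shows "coupled b b' \<or> coupled b' b"
proof -
  obtain R L where RL: "legal a R L" "R \<union> L = {i. collapsible a i}" "b = fire R L a"
    using b(1) unfolding psspm_step_iff by blast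
  obtain R' L' where RL': "legal a R' L'" "R' \<union> L' = {i. collapsible a i}" "b' = fire R' L' a"
    using b(2) unfolding psspm_step_iff by blast
  obtain p where p: "\<And>i. right_collapsible a i \<Longrightarrow> p \<le> i" "\<And>i. left_collapsible a i \<Longrightarrow> i \<le> p"
    using collapsible_separated[OF a] by blast
  have fin: "finite {i. a i \<noteq> 0}" using a by (simp add: sandpile_def)
  have off: "i \<in> X \<longleftrightarrow> right_collapsible a i" "i \<in> Y \<longleftrightarrow> left_collapsible a i"
    if "legal a X Y" "X \<union> Y = {i. collapsible a i}" "i \<noteq> p" for X Y i
  proof -
    have "\<not> (right_collapsible a i \<and> left_collapsible a i)"
      using p(1)[of i] p(2)[of i] \<open>i \<noteq> p\<close> by linarith
    then show "i \<in> X \<longleftrightarrow> right_collapsible a i" "i \<in> Y \<longleftrightarrow> left_collapsible a i"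
      using that unfolding legal_def set_eq_iff mem_Collect_eq collapsible_def Un_iff by blast+
  qed
  have m: "i \<in> R \<longleftrightarrow> i \<in> R'" "i \<in> L \<longleftrightarrow> i \<in> L'" if "i \<noteq> p" for i
    using off[OF RL(1,2) that] off[OF RL'(1,2) that] by simp_all
  have "p \<in> R \<or> p \<in> L \<longleftrightarrow> p \<in> R' \<or> p \<in> L'" using RL(2) RL'(2) by blast
  moreover have "p \<notin> R \<or> p \<notin> L" "p \<notin> R' \<or> p \<notin> L'" using RL(1) RL'(1) by (auto simp: legal_def)
  ultimately consider "p \<in> R \<longleftrightarrow> p \<in> R'" "p \<in> L \<longleftrightarrow> p \<in> L'"
    | "p \<in> R" "p \<notin> L" "p \<notin> R'" "p \<in> L'" | "p \<notin> R" "p \<in> L" "p \<in> R'" "p \<notin> L'" by blast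
  then show ?thesis
  proof cases
    case 1
    then have "i \<in> R \<longleftrightarrow> i \<in> R'" "i \<in> L \<longleftrightarrow> i \<in> L'" for i using m[of i] by (cases "i = p"; simp)+
    then have "R = R'" "L = L'" by blast+
    then show ?thesis using RL(3) RL'(3) by (simp add: coupled_def)
  next
    case 2
    have "cum b i \<le> cum b' i \<and> cum b' i \<le> cum b i + 1" for i
      unfolding RL(3) RL'(3) cum_fire[OF fin RL(1)] cum_fire[OF fin RL'(1)]
      using m(1)[of i] m(2)[of "i + 1"] 2 by (cases "i = p"; cases "i + 1 = p") (auto simp: of_bool_def)
    then show ?thesis by (simp add: coupled_def)
  next
    case 3
    have "cum b' i \<le> cum b i \<and> cum b i \<le> cum b' i + 1" for i
      unfolding RL(3) RL'(3) cum_fire[OF fin RL(1)] cum_fire[OF fin RL'(1)]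
      using m(1)[of i] m(2)[of "i + 1"] 3 by (cases "i = p"; cases "i + 1 = p") (auto simp: of_bool_def)
    then show ?thesis by (simp add: coupled_def)
  qed
qed

section \<open>The range of partial sums of fixed points\<close>

text \<open>First steps \<open>b\<close> towards \<open>f\<close> and \<open>b'\<close> towards
  \<open>g\<close> lead to coupled fixed points \<open>f'\<close> and \<open>g'\<close>, whose
  partial sums at \<open>e\<close> differ by at most 1. Hence \<open>s\<close> lies between
  \<open>f\<close> and \<open>f'\<close>, both reachable from \<open>b\<close>, or between
  \<open>g'\<close> and \<open>g\<close>, both reachable from \<open>b'\<close>.\<close>

lemma fixed_points_intermediate_value:
  assumes "sandpile n a"
    and "psspm_step\<^sup>*\<^sup>* a f" "stable_config f" "psspm_step\<^sup>*\<^sup>* a g" "stable_config g"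
    and "cum f e \<le> s" "s \<le> cum g e"
  shows "\<exists>k. psspm_step\<^sup>*\<^sup>* a k \<and> stable_config k \<and> cum k e = s"
  using assms
proof (induction "energy a" arbitrary: a f g rule: less_induct)
  case less
  show ?case
  proof (cases "stable_config a")
    case True
    then have "f = a" "g = a" using psspm_steps_stable less.prems by blast+
    then show ?thesis using less.prems by (metis order_antisym)
  next
    case False
    then obtain b b' where b: "psspm_step a b" "psspm_step\<^sup>*\<^sup>* b f" "psspm_step a b'" "psspm_step\<^sup>*\<^sup>* b' g"
      using less.prems(2-5) by (metis converse_rtranclpE)
    have sp: "sandpile n b" "sandpile n b'" using b less.prems(1) sandpile_psspm_step by blast+
    have en: "energy b < energy a" "energy b' < energy a"
      using b less.prems(1) False energy_psspm_step by blast+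
    obtain f' g' where f': "psspm_step\<^sup>*\<^sup>* b f'" "stable_config f'" and g': "psspm_step\<^sup>*\<^sup>* b' g'" "stable_config g'"
      and "coupled f' g' \<or> coupled g' f'"
      using coupled_successors[OF less.prems(1) b(1,3)] coupled_fixed_points sp by meson
    then have "cum g' e \<le> cum f' e + 1" by (auto simp: coupled_def intro: order_trans)
    then consider "s \<le> cum f' e" | "cum g' e \<le> s" by linarith
    then show ?thesis
    proof cases
      case 1
      then show ?thesis using less.hyps[OF en(1) sp(1) b(2) less.prems(3) f' less.prems(6)] b(1)
        by (meson converse_rtranclp_into_rtranclp)
    next
      case 2
      then show ?thesis using less.hyps[OF en(2) sp(2) g' b(4) less.prems(5) _ less.prems(7)] b(3)
        by (meson converse_rtranclp_into_rtranclp)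
    qed
  qed
qed

text \<open>This is \<open>S\<^sub>i(a) \<le> S\<^sub>i(a') + 1\<close> for the mirror image \<open>a'\<close> of \<open>a\<close> about the edge between columns
  0 and 1.\<close>
definition right_heavy :: "nat \<Rightarrow> config \<Rightarrow> bool" where
  "right_heavy n a \<longleftrightarrow> (\<forall>i. cum a i + cum a (- i) \<le> int n + 1)"

text \<open>If \<open>S_i + S_(-i) = n + 1\<close>, the second differences \<open>X\<close> at
  \<open>i\<close> and \<open>- i\<close> have a sum \<open>\<ge> 0\<close>, so a leftward crossing
  at one edge is offset by a rightward one at the other, which is taken because right is preferred.
  If the sum is \<open>n\<close>, they add up to at least -2, so the two edges cannot both
  gain.\<close>

lemma right_heavy_fire:
  assumes A: "finite {i. a i \<noteq> 0}" and rh: "right_heavy n a"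
    and L: "legal a {i. right_collapsible a i} L" "L = {i. left_collapsible a i} - {i. right_collapsible a i}"
  shows "right_heavy n (fire {i. right_collapsible a i} L a)"
  unfolding right_heavy_def
proof
  fix i :: int
  define u j where "u = cum a" and "j = - i"
  have rh': "u k + u l \<le> int n + 1" if "l = - k" for k l
    using rh that by (simp add: right_heavy_def u_def)
  have d: "u i + u j \<le> int n + 1" "u (i - 1) + u (j + 1) \<le> int n + 1" "u (i + 1) + u (j - 1) \<le> int n + 1"
    by (rule rh', simp add: j_def)+
  have h: "int (a j) = u j - u (j - 1)" for j
    using height_cum[OF A] by (simp_all add: u_def)
  have rc: "right_collapsible a j \<longleftrightarrow> 2 * u j - u (j - 1) - u (j + 1) \<ge> 2" for j
    by (auto simp: right_collapsible_def h)
  have lc: "left_collapsible a j \<longleftrightarrow> u j + u (j - 2) - 2 * u (j - 1) \<ge> 2" for j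
    by (auto simp: left_collapsible_def h)
  show "cum (fire {i. right_collapsible a i} L a) i + cum (fire {i. right_collapsible a i} L a) (- i) \<le> int n + 1"
    unfolding cum_fire[OF A L(1)]
    unfolding L(2) mem_Collect_eq Diff_iff rc lc u_def[symmetric] j_def[symmetric]
    using d by (simp add: of_bool_def)
qed

lemma right_heavy_fixed_point:
  assumes "sandpile n a" "right_heavy n a"
  shows "\<exists>f. psspm_step\<^sup>*\<^sup>* a f \<and> stable_config f \<and> right_heavy n f"
  using assms
proof (induction "energy a" arbitrary: a rule: less_induct)
  case less
  define R L where "R = {i. right_collapsible a i}" and "L = {i. left_collapsible a i} - R"
  define b where "b = fire R L a"
  have RL: "legal a R L" "R \<union> L = {i. collapsible a i}"
    by (auto simp: R_def L_def legal_def collapsible_def)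
  have step: "psspm_step a b" unfolding b_def by (rule psspm_stepI[OF RL])
  have "right_heavy n b"
    unfolding b_def R_def
    using right_heavy_fire[of a n L] less.prems RL(1) L_def R_def by (auto simp: sandpile_def)
  show ?case
  proof (cases "stable_config a")
    case False
    then obtain f where "psspm_step\<^sup>*\<^sup>* b f" "stable_config f" "right_heavy n f"
      using less.hyps[OF energy_psspm_step[OF less.prems(1) step] sandpile_psspm_step[OF less.prems(1) step]]
        \<open>right_heavy n b\<close> by blast
    then show ?thesis using converse_rtranclp_into_rtranclp[of psspm_step, OF step] by blast
  qed (use less.prems in blast)
qed

text \<open>While column 0 can collapse on the right it does so, and the negative columns stay
  empty. Once it cannot, \<open>2 * S_0 \<le> a 0 + a 1 + 1 \<le> n + 1\<close>; for
  \<open>i \<noteq> 0\<close> one of the two partial sums is 0.\<close>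

lemma right_heavy_reachable:
  assumes "sandpile n a" "\<forall>i<0. a i = 0"
  shows "\<exists>b. psspm_step\<^sup>*\<^sup>* a b \<and> right_heavy n b"
  using assms
proof (induction "energy a" arbitrary: a rule: less_induct)
  case less
  have fin: "finite {i. a i \<noteq> 0}" and tot: "\<exists>m. \<forall>i\<ge>m. cum a i = int n"
    using less.prems(1) by (auto simp: sandpile_def)
  show ?case
  proof (cases "right_collapsible a 0")
    case True
    define R L where "R = {i. right_collapsible a i}" and "L = {i. left_collapsible a i} - R"
    define b where "b = fire R L a"
    have RL: "legal a R L" "R \<union> L = {i. collapsible a i}"
      by (auto simp: R_def L_def legal_def collapsible_def)
    have step: "psspm_step a b" unfolding b_def by (rule psspm_stepI[OF RL])
    have "\<not> stable_config a" using True by (auto simp: stable_config_def collapsible_def)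
    moreover have "\<forall>i<0. b i = 0"
    proof (intro allI impI)
      fix i :: int assume i: "i < 0"
      have "a i = 0" "a (i - 1) = 0" using less.prems(2) i by auto
      moreover have "i + 1 \<notin> L"
        using True i less.prems(2) by (cases "i + 1 = 0") (auto simp: L_def R_def left_collapsible_def)
      moreover have "i - 1 \<notin> R" using \<open>a (i - 1) = 0\<close> by (auto simp: R_def right_collapsible_def)
      ultimately show "b i = 0" by (simp add: b_def fire_def)
    qed
    ultimately obtain c where "psspm_step\<^sup>*\<^sup>* b c" "right_heavy n c"
      using less.hyps[OF energy_psspm_step[OF less.prems(1) step] sandpile_psspm_step[OF less.prems(1) step]]
      by blast
    then show ?thesis using converse_rtranclp_into_rtranclp[of psspm_step, OF step] by blast
  next
    case False
    have neg: "cum a i = 0" if "i < 0" for i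
    proof -
      have "{j. j \<le> i \<and> a j \<noteq> 0} = {}" using less.prems(2) that by fastforce
      then show ?thesis unfolding cum_def by (metis sum.empty)
    qed
    have "cum a i + cum a (- i) \<le> int n + 1" for i
    proof (cases "i = 0")
      case True
      have "cum a 1 \<le> int n" using cum_le_total[OF fin tot] .
      then show ?thesis using True False neg[of "-1"] cum_rec[OF fin, of 0] cum_rec[OF fin, of 1]
        by (simp add: right_collapsible_def)
    next
      case False
      then show ?thesis using neg[of i] neg[of "-i"] cum_le_total[OF fin tot, of i] cum_le_total[OF fin tot, of "-i"]
        by (cases "i < 0") auto
    qed
    then show ?thesis unfolding right_heavy_def by blast
  qed
qed

text \<open>Let \<open>e\<close> be the first column where the mirror image \<open>g\<close> of a
  right-heavy \<open>f\<close> has partial sum at least \<open>s\<close>. Then \<open>S_e(f) \<le> n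
  + 1 - S_(-e)(f) = S_(e-1)(g) + 1 \<le> s \<le> S_e(g)\<close>, and the intermediate value property
  applies.\<close>

lemma fixed_point_with_partial_sum:
  assumes "1 \<le> s" "s \<le> int n"
  shows "\<exists>f e. psspm_step\<^sup>*\<^sup>* (initial n) f \<and> stable_config f \<and> cum f e = s"
proof -
  obtain b where b: "psspm_step\<^sup>*\<^sup>* (initial n) b" "right_heavy n b"
    using right_heavy_reachable[OF sandpile_initial] by (auto simp: initial_def)
  obtain f where f: "psspm_step\<^sup>*\<^sup>* b f" "stable_config f" "right_heavy n f"
    using right_heavy_fixed_point[OF sandpile_psspm_steps[OF b(1) sandpile_initial] b(2)] by blast
  have reach: "psspm_step\<^sup>*\<^sup>* (initial n) f" using b(1) f(1) by (rule rtranclp_trans)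
  define g where "g = mirror f"
  have g: "psspm_step\<^sup>*\<^sup>* (initial n) g" "stable_config g"
    using psspm_steps_mirror[OF reach] f(2) by (simp_all add: g_def)
  have sp: "sandpile n f" using reach sandpile_psspm_steps sandpile_initial by blast
  then have fin: "finite {i. f i \<noteq> 0}" and tot: "\<exists>m. \<forall>i\<ge>m. cum f i = int n"
    by (auto simp: sandpile_def)
  have sg: "sandpile n g" unfolding g_def using sp by (rule sandpile_mirror)
  then have fing: "finite {i. g i \<noteq> 0}" by (simp add: sandpile_def)
  obtain m where m: "\<And>i. i \<le> m \<Longrightarrow> cum g i = 0"
    using cum_eq_0[OF fing] by blast
  obtain m' where m': "\<And>i. i \<ge> m' \<Longrightarrow> cum g i = int n"
    using sg by (auto simp: sandpile_def)
  \<comment> \<open>Counting from \<open>m\<close>, left of which \<open>g\<close> is empty, turns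
    the search for the first column into a search over naturals.\<close>
  define k where "k = (LEAST k. s \<le> cum g (m + int k))"
  have "s \<le> cum g (m + int (nat (m' - m)))" using assms m' [of "m + int (nat (m' - m))"] by simp
  then have k: "s \<le> cum g (m + int k)" unfolding k_def by (rule LeastI)
  have "k \<noteq> 0" using k m[of m] assms by (auto intro: ccontr)
  then have "\<not> s \<le> cum g (m + int (k - 1))"
    unfolding k_def using not_less_Least[of "k - 1"] by (metis diff_less k_def less_numeral_extra(1) neq0_conv)
  then have k1: "cum g (m + int k - 1) < s" using \<open>k \<noteq> 0\<close> by (simp add: of_nat_diff algebra_simps)
  define e where "e = m + int k"
  have "cum f e + cum f (- e) \<le> int n + 1" using f(3) by (simp add: right_heavy_def)
  moreover have "cum g (e - 1) = int n - cum f (- e)"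
    unfolding g_def cum_mirror[OF fin tot] by simp
  ultimately have "cum f e \<le> s" using k1 by (simp add: e_def)
  moreover have "s \<le> cum g e" using k by (simp add: e_def)
  ultimately show ?thesis
    using fixed_points_intermediate_value[OF sandpile_initial reach f(2) g] by blast
qed

section \<open>The pyramid\<close>

text \<open>With \<open>s = a i\<close>, the heights from column \<open>i\<close> on are at most
  \<open>s, s, s - 1, ..., 1\<close>, whose sum is \<open>s * (s + 3) / 2\<close>.\<close>

lemma tail_sum_bound:
  assumes fin: "finite {i. a i \<noteq> 0}" and tot: "\<exists>m. \<forall>i\<ge>m. cum a i = int n"
    and desc: "descends a c" and "c \<le> i"
  shows "2 * (int n - cum a (i - 1)) \<le> int (a i) * (int (a i) + 3)"
proof -
  define s where "s = a i"
  \<comment> \<open>The subtracted term is twice the room \<open>(s - k) + ... + 1\<close> left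
    beyond column \<open>i + k\<close>; truncated subtraction makes it 0 for
    \<open>k \<ge> s\<close>.\<close>
  have bound: "2 * (cum a (i + int k) - cum a (i - 1)) \<le> int s * (int s + 3) - int (s - k) * (int (s - k) + 1)" for k
  proof (induction k)
    case 0
    then show ?case using cum_rec[OF fin, of i] by (simp add: s_def algebra_simps)
  next
    case (Suc k)
    have r: "cum a (i + int (Suc k)) = cum a (i + int k) + int (a (i + int (Suc k)))"
      using cum_rec[OF fin, of "i + int (Suc k)"] by simp
    have le: "int (a (i + int (Suc k))) \<le> int (s - k)"
    proof (cases "a (i + int (Suc k)) > 0")
      case True
      then have "int (a (i + int (Suc k))) + int (Suc k) \<le> int s + 1"
        using desc[unfolded descends_def, rule_format, of i "i + int (Suc k)"] \<open>c \<le> i\<close>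
        unfolding s_def by simp
      then show ?thesis by linarith
    qed simp
    show ?case
    proof (cases "k < s")
      case True
      define q where "q = int (s - Suc k)"
      have q: "int (s - k) = q + 1" using True by (simp add: q_def)
      define Z W where "Z = q * (q + 1)" and "W = int s * (int s + 3)"
      have "(q + 1) * (q + 1 + 1) = Z + 2 * (q + 1)" by (simp add: Z_def algebra_simps)
      then have "2 * (cum a (i + int k) - cum a (i - 1)) \<le> W - (Z + 2 * (q + 1))"
        using Suc unfolding q W_def[symmetric] by metis
      moreover define C v where "C = cum a (i + int (Suc k))" and "v = int (a (i + int (Suc k)))"
      ultimately show ?thesis
        using r le unfolding q q_def[symmetric] Z_def[symmetric] W_def[symmetric] C_def[symmetric] v_def[symmetric]
        by (auto simp: algebra_simps)
    next
      case False
      with Suc r le show ?thesis by simp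
    qed
  qed
  obtain m where m: "\<And>i. i \<ge> m \<Longrightarrow> cum a i = int n" using tot by blast
  have "cum a (i + int (nat (m - i))) = int n" by (rule m) simp
  then have "2 * (int n - cum a (i - 1)) \<le> int s * (int s + 3)
      - int (s - nat (m - i)) * (int (s - nat (m - i)) + 1)" using bound[of "nat (m - i)"] by metis
  also have "\<dots> \<le> int s * (int s + 3)" by simp
  finally show ?thesis by (simp add: s_def)
qed

text \<open>For \<open>s \<le> h - 2\<close> the bound is at most
  \<open>(h - 2) * (h + 1) = h * (h - 1) - 2\<close>, too small for \<open>T\<close> grains.\<close>

lemma triangular_bound:
  assumes "2 * T = int h * (int h - 1)" "2 * T \<le> int s * (int s + 3)"
  shows "int h - 1 \<le> int s"
proof (rule ccontr)
  assume "\<not> int h - 1 \<le> int s"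
  then have "int s \<le> int h - 2" by simp
  then have "int s * (int s + 3) \<le> (int h - 2) * (int h - 2 + 3)"
    by (intro mult_mono) auto
  then show False using assms by (simp add: algebra_simps)
qed

text \<open>The first condition is \<open>0 \<le> S\<^sub>i(a) - S\<^sub>i(mirror a) \<le> 1\<close>; the other two cap the grains on either
  side of column 0.\<close>
definition balanced :: "nat \<Rightarrow> int \<Rightarrow> config \<Rightarrow> bool" where
  "balanced n T a \<longleftrightarrow> (\<forall>i. int n \<le> cum a i + cum a (- i - 1) \<and> cum a i + cum a (- i - 1) \<le> int n + 1)
     \<and> cum a (- 1) \<le> T \<and> int n - T \<le> cum a 0"

text \<open>At a tie in column 0 the grain goes to the side that is behind. The caps persist because a side
  holding \<open>T\<close> grains has height at least \<open>h - 1\<close> next to column 0.\<close>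
lemma balanced_step:
  assumes sp: "sandpile n a" and bal: "balanced n T a" and n: "n = h * h" and T: "2 * T = int h * (int h - 1)"
  shows "\<exists>b. psspm_step a b \<and> balanced n T b"
proof -
  \<comment> \<open>Away from column 0 this is \<open>rightward a (mirror a)\<close>. A tie at
    column 0 goes left if both sides hold equally many grains, and right if the left side is one
    ahead.\<close>
  define R where "R = {i. right_collapsible a i \<and> \<not> (left_collapsible a i \<and>
    (if i = 0 then cum a 0 + cum a (- 1) = int n else right_collapsible a (- i) \<and> \<not> left_collapsible a (- i)))}"
  define L where "L = {i. left_collapsible a i} - R"
  define b where "b = fire R L a"
  have RL: "legal a R L" "R \<union> L = {i. collapsible a i}"
    by (auto simp: R_def L_def legal_def collapsible_def)
  have fin: "finite {i. a i \<noteq> 0}" and tot: "\<exists>m. \<forall>i\<ge>m. cum a i = int n"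
    using sp by (auto simp: sandpile_def)
  obtain c where c: "twosided a c" using sp by (auto simp: sandpile_def)
  define u where "u = cum a"
  have d: "int n \<le> u i + u j \<and> u i + u j \<le> int n + 1" if "j = - i - 1" for i j
    using bal that by (simp add: balanced_def u_def)
  have h: "int (a j) = u j - u (j - 1)" for j
    using height_cum[OF fin] by (simp_all add: u_def)
  have rc: "right_collapsible a j \<longleftrightarrow> 2 * u j - u (j - 1) - u (j + 1) \<ge> 2" for j
    by (auto simp: right_collapsible_def h)
  have lc: "left_collapsible a j \<longleftrightarrow> u j + u (j - 2) - 2 * u (j - 1) \<ge> 2" for j
    by (auto simp: left_collapsible_def h)
  have uT: "u (- 1) \<le> T" "int n - T \<le> u 0" using bal by (auto simp: balanced_def u_def)
  have n': "int n = 2 * T + int h" using n T by (simp add: algebra_simps)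
  have R0: "0 \<in> R \<longleftrightarrow> right_collapsible a 0 \<and> \<not> (left_collapsible a 0 \<and> u 0 + u (- 1) = int n)"
    by (auto simp: R_def u_def)
  have Lm: "i \<in> L \<longleftrightarrow> left_collapsible a i \<and> i \<notin> R" for i by (auto simp: L_def)
  obtain p where p: "\<And>i. right_collapsible a i \<Longrightarrow> p \<le> i" "\<And>i. left_collapsible a i \<Longrightarrow> i \<le> p"
    using collapsible_separated[OF sp] by blast
  have uni: "\<not> (right_collapsible a i \<and> left_collapsible a i \<and> right_collapsible a j \<and> left_collapsible a j)"
    if "i \<noteq> j" for i j
    using p(1)[of i] p(2)[of i] p(1)[of j] p(2)[of j] that by linarith
  have cb: "cum b i = u i - of_bool (i \<in> R) + of_bool (i + 1 \<in> L)" for i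
    unfolding b_def u_def by (rule cum_fire[OF fin RL(1)])
  have RLc: "i \<in> R \<Longrightarrow> right_collapsible a i" "i \<in> L \<Longrightarrow> left_collapsible a i" for i
    by (simp_all add: R_def L_def)
  \<comment> \<open>By \<open>uni\<close> the columns \<open>i\<close> and \<open>- i\<close> are
    not both tied, so the tie rule lets a possible pair of mirrored moves happen together.\<close>
  have opp: "right_collapsible a i \<and> left_collapsible a k \<longrightarrow> i \<in> R \<and> k \<in> L" if "i \<noteq> 0" "k = - i" for i k
    using that uni[of i k] by (auto simp: R_def L_def)
  \<comment> \<open>The edges right of \<open>i\<close> and of \<open>j\<close> are mirror images
    about column 0. The bounds on \<open>X + Y\<close> exclude two crossings in the same direction,
    and allow a lone leftward crossing only at sum \<open>n\<close> and a lone rightward one only at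
    \<open>n + 1\<close>; opposite crossings cancel.\<close>
  have edge: "int n \<le> cum b i + cum b j \<and> cum b i + cum b j \<le> int n + 1"
    if ij: "j = - i - 1" and right: "right_collapsible a i \<and> left_collapsible a (j + 1) \<longrightarrow> i \<in> R \<and> j + 1 \<in> L"
      and left: "right_collapsible a j \<and> left_collapsible a (i + 1) \<longrightarrow> j \<in> R \<and> i + 1 \<in> L" for i j
  proof -
    define X Y where "X = 2 * u i - u (i - 1) - u (i + 1)" and "Y = 2 * u j - u (j - 1) - u (j + 1)"
    have c: "right_collapsible a i \<longleftrightarrow> X \<ge> 2" "left_collapsible a (i + 1) \<longleftrightarrow> X \<le> - 2"
      "right_collapsible a j \<longleftrightarrow> Y \<ge> 2" "left_collapsible a (j + 1) \<longleftrightarrow> Y \<le> - 2"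
      unfolding rc lc X_def Y_def by auto
    have e: "int n \<le> u i + u j" "u i + u j \<le> int n + 1"
      "2 * (u i + u j - int n) - 2 \<le> X + Y" "X + Y \<le> 2 * (u i + u j - int n)"
      using d[of j i] d[of "j - 1" "i + 1"] d[of "j + 1" "i - 1"] ij unfolding X_def Y_def by auto
    have m: "i \<in> R \<Longrightarrow> X \<ge> 2" "i + 1 \<in> L \<Longrightarrow> X \<le> - 2" "j \<in> R \<Longrightarrow> Y \<ge> 2" "j + 1 \<in> L \<Longrightarrow> Y \<le> - 2"
      using RLc(1)[of i] RLc(1)[of j] RLc(2)[of "i + 1"] RLc(2)[of "j + 1"] c by blast+
    consider "X \<ge> 2 \<and> Y \<le> - 2 \<or> X \<le> - 2 \<and> Y \<ge> 2" | "X < 2" "Y < 2" | "X < 2" "X > - 2" | "Y < 2" "Y > - 2" | "X > - 2" "Y > - 2"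
      by linarith
    then show ?thesis
    proof cases
      case 1
      then have "i \<in> R \<and> j + 1 \<in> L \<and> j \<notin> R \<and> i + 1 \<notin> L \<or> j \<in> R \<and> i + 1 \<in> L \<and> i \<notin> R \<and> j + 1 \<notin> L"
        using 1 right left m unfolding c by linarith
      then show ?thesis using e by (auto simp: cb)
    next
      case 2
      then have "i \<notin> R" "j \<notin> R" using m by auto
      then show ?thesis using e m 2 by (cases "i + 1 \<in> L"; cases "j + 1 \<in> L"; simp add: cb)
    next
      case 3
      then have "i \<notin> R" "i + 1 \<notin> L" using m by auto
      then show ?thesis using e m 3 by (cases "j \<in> R"; cases "j + 1 \<in> L"; simp add: cb)
    next
      case 4
      then have "j \<notin> R" "j + 1 \<notin> L" using m by auto
      then show ?thesis using e m 4 by (cases "i \<in> R"; cases "i + 1 \<in> L"; simp add: cb)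
    next
      case 5
      then have "i + 1 \<notin> L" "j + 1 \<notin> L" using m by auto
      then show ?thesis using e m 5 by (cases "i \<in> R"; cases "j \<in> R"; simp add: cb)
    qed
  qed
  \<comment> \<open>Both edges adjoin column 0. If it is tied, its neighbours send nothing back, and
    its grain toggles the sum between \<open>n\<close> and \<open>n + 1\<close>.\<close>
  have cen: "int n \<le> cum b 0 + cum b (- 1) \<and> cum b 0 + cum b (- 1) \<le> int n + 1"
  proof (cases "right_collapsible a 0 \<and> left_collapsible a 0")
    case True
    then have "1 \<notin> L" "- 1 \<notin> R"
      using RLc(2)[of 1] RLc(1)[of "- 1"] by (auto simp: right_collapsible_def left_collapsible_def)
    with True show ?thesis using d[of "-1" 0] R0 Lm[of 0] by (auto simp: cb of_bool_def)
  next
    case False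
    then show ?thesis using edge[of "-1" 0] opp[of "-1" 1] by auto
  qed
  have "int n \<le> cum b i + cum b (- i - 1) \<and> cum b i + cum b (- i - 1) \<le> int n + 1" for i
  proof -
    consider "i = 0" | "i = - 1" | "i \<noteq> 0" "- i - 1 \<noteq> 0" by force
    then show ?thesis
    proof cases
      case 3
      then show ?thesis
        using edge[of "- i - 1" i] opp[of i "- i - 1 + 1"] opp[of "- i - 1" "i + 1"] by linarith
    qed (use cen in \<open>simp_all add: add.commute\<close>)
  qed
  moreover have "cum b (- 1) \<le> T"
  proof (rule ccontr)
    assume "\<not> cum b (- 1) \<le> T"
    then have l: "u (- 1) = T" "0 \<in> L"
      using uT(1) cb[of "-1"] by (auto simp: of_bool_def split: if_splits)
    then have lc0: "left_collapsible a 0" "0 \<notin> R" by (auto simp: L_def)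
    then have "0 \<le> c" using twosided_collapsible(2)[OF c] by blast
    then have "2 * (int n - cum (mirror a) (1 - 1)) \<le> int (mirror a 1) * (int (mirror a 1) + 3)"
      using c finite_supp_mirror[of a] fin total_mirror[OF fin tot]
      by (intro tail_sum_bound[of _ _ "1 - c"]) (auto simp: twosided_def)
    then have "2 * T \<le> int (a (- 1)) * (int (a (- 1)) + 3)"
      unfolding cum_mirror[OF fin tot] using l(1) by (simp add: mirror_def u_def)
    then have "int h - 1 \<le> int (a (- 1))" by (rule triangular_bound[OF T])
    moreover have "right_collapsible a 0 \<Longrightarrow> u 0 + u (- 1) = int n"
      using lc0 R0 by blast
    \<comment> \<open>The sum bound gives \<open>a 0 \<le> h + 1\<close>, so the left cliff forces
      \<open>a 0 = h + 1\<close>, \<open>a (- 1) = h - 1\<close> and sum \<open>n + 1\<close>.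
      Column 0 is then not tied, so \<open>a 1 \<ge> h\<close>, which makes
      \<open>S_1 + S_(-2) \<ge> n + 2\<close>.\<close>
    ultimately show False
      using d[of "-1" 0] d[of "-2" 1] l(1) n' lc0(1) h[of "-1"] unfolding rc lc by simp
  qed
  moreover have "int n - T \<le> cum b 0"
  proof (rule ccontr)
    assume "\<not> int n - T \<le> cum b 0"
    then have l: "u 0 = int n - T" "0 \<in> R"
      using uT(2) cb[of 0] by (auto simp: of_bool_def split: if_splits)
    then have rc0: "right_collapsible a 0" by (auto simp: R_def)
    then have "c \<le> 1" using twosided_collapsible(1)[OF c, of 0] by simp
    then have "2 * (int n - cum a (1 - 1)) \<le> int (a 1) * (int (a 1) + 3)"
      using c by (intro tail_sum_bound[OF fin tot, of c]) (auto simp: twosided_def)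
    then have "int h - 1 \<le> int (a 1)"
      using l(1) by (intro triangular_bound[OF T]) (simp add: u_def)
    \<comment> \<open>Here \<open>S_(-1) = T\<close> is forced, so \<open>a 0 = h\<close>, one short
      of a right cliff above \<open>a 1 \<ge> h - 1\<close>.\<close>
    then show False
      using d[of "-1" 0] uT(1) l(1) n' rc0 h[of 1] unfolding rc by simp
  qed
  ultimately have "balanced n T b" by (simp add: balanced_def)
  then show ?thesis using psspm_stepI[OF RL] unfolding b_def by blast
qed

lemma balanced_fixed_point:
  assumes "sandpile n a" "balanced n T a" "n = h * h" "2 * T = int h * (int h - 1)"
  shows "\<exists>f. psspm_step\<^sup>*\<^sup>* a f \<and> stable_config f \<and> balanced n T f"
  using assms(1,2)
proof (induction "energy a" arbitrary: a rule: less_induct)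
  case less
  obtain b where step: "psspm_step a b" and "balanced n T b"
    using balanced_step[OF less.prems assms(3,4)] by blast
  show ?case
  proof (cases "stable_config a")
    case False
    then obtain f where "psspm_step\<^sup>*\<^sup>* b f" "stable_config f" "balanced n T f"
      using less.hyps[OF energy_psspm_step[OF less.prems(1) step] sandpile_psspm_step[OF less.prems(1) step]]
        \<open>balanced n T b\<close> by blast
    then show ?thesis using converse_rtranclp_into_rtranclp[of psspm_step, OF step] by blast
  qed (use less.prems in blast)
qed

lemma cum_initial: "cum (initial n) i = (if 0 \<le> i then int n else 0)"
proof (rule cum_unique)
  show "finite {i. initial n i \<noteq> 0}"
    by (rule finite_subset[of _ "{0}"]) (auto simp: initial_def)
  show "(if 0 \<le> i then int n else 0) = 0" if "i \<le> - 1" for i :: int using that by simp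
qed (auto simp: initial_def)

text \<open>The caps leave at least \<open>n - 2 * T = h\<close> grains in column 0, a height that
  singles out the pyramid.\<close>

lemma square_fixed_point:
  assumes "n = h * h"
  shows "\<exists>f. psspm_step\<^sup>*\<^sup>* (initial n) f \<and> stable_config f \<and> f 0 \<ge> h"
proof -
  define T where "T = (int h * (int h - 1)) div 2"
  have T: "2 * T = int h * (int h - 1)" by (simp add: T_def)
  have "0 \<le> T" unfolding T_def by (cases h) auto
  then have "balanced n T (initial n)" by (auto simp: balanced_def cum_initial)
  then obtain f where f: "psspm_step\<^sup>*\<^sup>* (initial n) f" "stable_config f" "balanced n T f"
    using balanced_fixed_point[OF sandpile_initial _ assms T] by blast
  have "sandpile n f" using f(1) sandpile_initial sandpile_psspm_steps by blast
  then have "int (f 0) = cum f 0 - cum f (0 - 1)" by (intro height_cum) (simp add: sandpile_def)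
  then have "int h \<le> int (f 0)" using f(3) T assms by (simp add: balanced_def algebra_simps)
  then show ?thesis using f by auto
qed

section \<open>Staircases and the classification of fixed points\<close>

text \<open>The stable one-sided pile \<open>t, t - 1, \<dots>, 1\<close> with the value \<open>q\<close> repeated (not for \<open>q = 0\<close>).\<close>
definition stair :: "nat \<Rightarrow> nat \<Rightarrow> nat \<Rightarrow> nat" where
  "stair t q k = t + of_bool (t < k + q) - k"

definition tri :: "nat \<Rightarrow> nat" where
  "tri t = t * (t + 1) div 2"

lemma two_tri: "2 * tri t = t * (t + 1)"
  by (simp add: tri_def)

lemma tri_Suc: "tri (Suc t) = tri t + Suc t"
  using two_tri[of t] two_tri[of "Suc t"] by (simp add: algebra_simps)

lemma stair_0: "q \<le> t \<Longrightarrow> stair t q 0 = t"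
  by (simp add: stair_def)

lemma stair_Suc: "stair (Suc t) q (Suc k) = stair t q k"
  by (simp add: stair_def)

lemma stair_le: "q \<le> t \<Longrightarrow> stair t q k \<le> t"
  by (cases k) (auto simp: stair_def)

lemma stair_full: "stair t (Suc t) = stair (Suc t) 0"
  by (rule ext) (auto simp: stair_def of_bool_def)

lemma stair_full_Suc: "stair t t (Suc k) = stair t 0 k"
  by (cases t) (simp_all add: stair_Suc stair_full, simp add: stair_def)

lemma sum_stair_0: "t \<le> m \<Longrightarrow> (\<Sum>k<m. stair t 0 k) = tri t"
proof (induction t arbitrary: m)
  case 0 then show ?case by (simp add: stair_def tri_def of_bool_def)
next
  case (Suc t)
  then obtain m' where m': "m = Suc m'" "t \<le> m'" by (cases m) auto
  then show ?case
    using Suc.IH[OF m'(2)] by (simp add: sum.lessThan_Suc_shift stair_Suc stair_0 tri_Suc del: sum.lessThan_Suc)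
qed

lemma sum_stair: "q \<le> t \<Longrightarrow> t < m \<Longrightarrow> (\<Sum>k<m. stair t q k) = tri t + q"
proof (induction t arbitrary: m)
  case 0 then show ?case by (simp add: stair_def tri_def of_bool_def)
next
  case (Suc t)
  then obtain m' where m': "m = Suc m'" "t < m'" by (cases m) auto
  show ?case
  proof (cases "q = Suc t")
    case True
    then show ?thesis
      using sum_stair_0[of "Suc t" m'] m'
      by (simp add: sum.lessThan_Suc_shift stair_Suc stair_0 stair_full tri_Suc del: sum.lessThan_Suc)
  next
    case False
    then show ?thesis
      using Suc.IH[of m'] Suc.prems m'
      by (simp add: sum.lessThan_Suc_shift stair_Suc stair_0 tri_Suc del: sum.lessThan_Suc)
  qed
qed

text \<open>The quantity \<open>b k + k\<close> is nondecreasing, starts at \<open>b 0\<close> and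
  is at most \<open>b 0 + 1\<close> while \<open>b k > 0\<close>, so it jumps at most once there.
  The jump position \<open>k0\<close> gives the repeated value \<open>b 0 + 1 - k0\<close>, with 0
  for no repetition.\<close>

lemma stable_half_line:
  fixes b :: "nat \<Rightarrow> nat"
  assumes slope: "\<And>k. b k \<le> b (Suc k) + 1"
    and bound: "\<And>k. 0 < k \<Longrightarrow> 0 < b k \<Longrightarrow> b k + k \<le> b 0 + 1"
  obtains q where "q \<le> b 0" "\<And>k. b k = stair (b 0) q k"
proof -
  define t where "t = b 0"
  have mono: "b k + k \<le> b (k + d) + (k + d)" for k d
  proof (induction d)
    case (Suc d) then show ?case using slope[of "k + d"] by simp
  qed simp
  define k0 where "k0 = (LEAST k. t + 1 \<le> b k + k)"
  have ex: "t + 1 \<le> b (t + 1) + (t + 1)" by simp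
  have k0: "t + 1 \<le> b k0 + k0" unfolding k0_def using LeastI[of "\<lambda>k. t + 1 \<le> b k + k", OF ex] .
  have "k0 \<le> t + 1" unfolding k0_def using Least_le[of "\<lambda>k. t + 1 \<le> b k + k", OF ex] .
  have "k0 \<noteq> 0" using k0 by (auto simp: t_def intro: ccontr)
  show ?thesis
  proof
    show "t + 1 - k0 \<le> b 0" using \<open>k0 \<noteq> 0\<close> by (simp add: t_def)
    show "b k = stair (b 0) (t + 1 - k0) k" for k
    proof (cases "k < k0")
      case True
      then have "b k + k < t + 1" unfolding k0_def using not_less_Least by fastforce
      moreover have "t \<le> b k + k" using mono[of 0 k] by (simp add: t_def)
      ultimately have "b k = t - k" "\<not> t < k + (t + 1 - k0)" using True \<open>k0 \<le> t + 1\<close> by linarith+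
      then show ?thesis by (simp add: stair_def t_def[symmetric])
    next
      case False
      then have "t + 1 \<le> b k + k" using k0 mono[of k0 "k - k0"] by simp
      moreover have "0 < b k \<Longrightarrow> b k + k \<le> t + 1" using bound[of k] False \<open>k0 \<noteq> 0\<close> by (simp add: t_def)
      ultimately show ?thesis using False \<open>k0 \<le> t + 1\<close>
        by (cases "b k = 0") (auto simp: stair_def t_def[symmetric])
    qed
  qed
qed

section \<open>Stable configurations and their index\<close>

definition left_stair :: "config \<Rightarrow> int \<Rightarrow> nat \<Rightarrow> nat \<Rightarrow> bool" where
  "left_stair a c t q \<longleftrightarrow> (\<forall>k. a (c - 1 - int k) = stair t q k)"

definition right_stair :: "config \<Rightarrow> int \<Rightarrow> nat \<Rightarrow> nat \<Rightarrow> bool" where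
  "right_stair a c t q \<longleftrightarrow> (\<forall>k. a (c + int k) = stair t q k)"

lemma left_stair_mirror: "left_stair a c t q \<longleftrightarrow> right_stair (mirror a) (1 - c) t q"
  by (simp add: left_stair_def right_stair_def mirror_def algebra_simps)

lemma stable_slope: "stable_config a \<Longrightarrow> a i \<le> a (i + 1) + 1" "stable_config a \<Longrightarrow> a (i + 1) \<le> a i + 1"
proof -
  assume s: "stable_config a"
  have "\<not> right_collapsible a i" "\<not> left_collapsible a (i + 1)"
    using s by (auto simp: stable_config_def collapsible_def)
  then show "a i \<le> a (i + 1) + 1" "a (i + 1) \<le> a i + 1"
    by (simp_all add: right_collapsible_def left_collapsible_def)
qed

lemma stable_right_stair:
  assumes "stable_config a" "descends a c"
  obtains q where "q \<le> a c" "right_stair a c (a c) q"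
proof -
  have "a (c + int k) \<le> a (c + int (Suc k)) + 1" for k
    using stable_slope(1)[OF assms(1), of "c + int k"] by (simp add: ac_simps)
  moreover have "a (c + int k) + k \<le> a (c + int 0) + 1" if "0 < k" "0 < a (c + int k)" for k
    using assms(2)[unfolded descends_def, rule_format, of c "c + int k"] that by simp
  ultimately obtain q where "q \<le> a (c + int 0)" "\<And>k. a (c + int k) = stair (a (c + int 0)) q k"
    using stable_half_line[of "\<lambda>k. a (c + int k)"] by metis
  then show ?thesis using that by (simp add: right_stair_def)
qed

lemma cum_tail:
  assumes "finite {i. a i \<noteq> 0}"
  shows "cum a (c - 1 + int m) = cum a (c - 1) + (\<Sum>k<m. int (a (c + int k)))"
proof (induction m)
  case (Suc m)
  then show ?case using cum_rec[OF assms, of "c + int m"] by (simp add: algebra_simps)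
qed simp

lemma cum_right_stair:
  assumes fin: "finite {i. a i \<noteq> 0}" and tot: "\<exists>m. \<forall>i\<ge>m. cum a i = int n"
    and a: "right_stair a c t q" "q \<le> t"
  shows "int n - cum a (c - 1) = int (tri t + q)"
proof -
  obtain m where m: "\<And>i. i \<ge> m \<Longrightarrow> cum a i = int n" using tot by blast
  define l where "l = t + 1 + nat (m - c)"
  have "(\<Sum>k<l. int (a (c + int k))) = int (\<Sum>k<l. stair t q k)"
    using a(1) by (simp add: right_stair_def)
  also have "\<dots> = int (tri t + q)" using sum_stair[OF a(2), of l] by (simp add: l_def)
  finally have "cum a (c - 1 + int l) = cum a (c - 1) + int (tri t + q)"
    using cum_tail[OF fin, of c l] by simp
  moreover have "cum a (c - 1 + int l) = int n" by (rule m) (simp add: l_def)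
  ultimately show ?thesis by simp
qed

lemma cum_left_stair:
  assumes fin: "finite {i. a i \<noteq> 0}" and tot: "\<exists>m. \<forall>i\<ge>m. cum a i = int n"
    and a: "left_stair a c t q" "q \<le> t"
  shows "cum a (c - 1) = int (tri t + q)"
proof -
  have "finite {i. mirror a i \<noteq> 0}" using fin finite_supp_mirror by blast
  from cum_right_stair[OF this total_mirror[OF fin tot], of "1 - c" t q] a
  have "int n - cum (mirror a) (1 - c - 1) = int (tri t + q)" by (simp add: left_stair_mirror)
  then show ?thesis unfolding cum_mirror[OF fin tot] by simp
qed

text \<open>What remains, for \<open>n = h\<^sup>2 + r\<close>, to the right of a cut with the staircase \<open>stair (h - 1) x\<close> on its left.
  In the last case the top height \<open>h\<close> occurs twice, and the right part need not be a staircase.\<close>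
definition right_part :: "nat \<Rightarrow> nat \<Rightarrow> nat \<Rightarrow> nat \<Rightarrow> nat" where
  "right_part h r x k = (if r < x then stair (h - 1) (r + h - x) k
     else if r \<le> x + h then stair h (r - x) k
     else if k = 0 then h else stair h (r - h - x) (k - 1))"

text \<open>For given \<open>h\<close> and \<open>r\<close> the index \<open>x\<close> alone
  determines the form; \<open>p\<close> only locates the cut.\<close>

definition has_index :: "nat \<Rightarrow> nat \<Rightarrow> config \<Rightarrow> nat \<Rightarrow> int \<Rightarrow> bool" where
  "has_index h r a x p \<longleftrightarrow> left_stair a p (h - 1) x \<and> (\<forall>k. a (p + int k) = right_part h r x k)"

text \<open>For shifting the cut one column to the left. If the top value is the repeated one, a
  plain staircase of the same height remains.\<close>

lemma left_stair_peel:
  assumes "left_stair a c t q" "q \<le> t" "0 < t"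
  shows "a (c - 1) = t" "q < t \<Longrightarrow> left_stair a (c - 1) (t - 1) q" "q = t \<Longrightarrow> left_stair a (c - 1) t 0"
proof -
  have a: "a (c - 1 - int k) = stair t q k" for k using assms(1) by (simp add: left_stair_def)
  show "a (c - 1) = t" using a[of 0] assms stair_0 by simp
  have s: "a (c - 1 - 1 - int k) = stair t q (Suc k)" for k using a[of "Suc k"] by (simp add: algebra_simps)
  show "q < t \<Longrightarrow> left_stair a (c - 1) (t - 1) q"
    unfolding left_stair_def s using stair_Suc[of "t - 1" q] assms(3) by simp
  show "q = t \<Longrightarrow> left_stair a (c - 1) t 0"
    unfolding left_stair_def s by (simp add: stair_full_Suc)
qed

lemma right_stair_extend:
  assumes "right_stair a c u q"
  shows "a (c - 1) = u + 1 \<Longrightarrow> q \<le> u + 1 \<Longrightarrow> right_stair a (c - 1) (u + 1) q"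
    "a (c - 1) = u \<Longrightarrow> q = 0 \<Longrightarrow> right_stair a (c - 1) u u"
proof -
  have a: "a (c - 1 + int (Suc k)) = stair u q k" for k
    using assms by (simp add: right_stair_def)
  have *: "right_stair a (c - 1) t q'" if "a (c - 1) = stair t q' 0" "\<And>k. stair u q k = stair t q' (Suc k)" for t q'
    unfolding right_stair_def
  proof
    fix k show "a (c - 1 + int k) = stair t q' k"
      using a[of "k - 1"] that by (cases k) simp_all
  qed
  show "a (c - 1) = u + 1 \<Longrightarrow> q \<le> u + 1 \<Longrightarrow> right_stair a (c - 1) (u + 1) q"
    by (rule *) (simp_all add: stair_0 stair_Suc)
  show "a (c - 1) = u \<Longrightarrow> q = 0 \<Longrightarrow> right_stair a (c - 1) u u"
    by (rule *) (simp_all add: stair_0 stair_full_Suc)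
qed

text \<open>The left top column passes to the right part, which then begins with
  \<open>h, h\<close>. For \<open>q' = 0\<close> this is \<open>stair h h\<close>, otherwise it is
  the last case of \<open>right_part\<close>.\<close>

lemma has_index_plateau:
  assumes "left_stair a c h q" "q < h" "right_stair a c h q'" "r = h + q + q'" "q' \<le> h"
  shows "has_index h r a q (c - 1)"
proof -
  have p: "a (c - 1) = h" "left_stair a (c - 1) (h - 1) q" using left_stair_peel[OF assms(1)] assms(2) by auto
  have "a (c - 1 + int k) = right_part h r q k" for k
  proof (cases "q' = 0")
    case True
    then have "right_stair a (c - 1) h h" using right_stair_extend(2)[OF assms(3)] p(1) by simp
    then show ?thesis using True assms(4) by (simp add: right_stair_def right_part_def)
  next
    case False
    have "a (c - 1 + int (Suc j)) = stair h q' j" for j using assms(3) by (simp add: right_stair_def)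
    then show ?thesis using p(1) False assms(4) by (cases k) (simp_all add: right_part_def)
  qed
  with p show ?thesis by (simp add: has_index_def)
qed

lemma square_decomposition_unique:
  fixes h k r s :: nat
  assumes "h * h + r = k * k + s" "r \<le> 2 * h" "s \<le> 2 * k"
  shows "h = k \<and> r = s"
proof -
  have le: "h \<le> k" if "h * h + r = k * k + s" "r \<le> 2 * h" "s \<le> 2 * k" for h k r s :: nat
  proof (rule ccontr)
    assume "\<not> h \<le> k"
    then have "Suc k * Suc k \<le> h * h" by (intro mult_mono) auto
    then show False using that by simp
  qed
  have "h = k" using le[of h r k s] le[of k s h r] assms by simp
  then show ?thesis using assms by simp
qed

text \<open>Both sides of the cut are staircases whose tops differ by at most 1. Uniqueness of
  \<open>n = h * h + r\<close> identifies \<open>h\<close> and \<open>r\<close>, and shifting the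
  cut left by at most two columns gives the left side top \<open>h - 1\<close> and a repeated value
  below \<open>h\<close>.\<close>

lemma stable_has_index:
  assumes sp: "sandpile n a" and st: "stable_config a" and n: "n = h * h + r" "r \<le> 2 * h" and h: "0 < h"
  shows "\<exists>x<h. \<exists>p. has_index h r a x p"
proof -
  obtain c where c: "descends a c" "descends (mirror a) (1 - c)" using sp by (auto simp: sandpile_def twosided_def)
  have fin: "finite {i. a i \<noteq> 0}" and tot: "\<exists>m. \<forall>i\<ge>m. cum a i = int n" using sp by (auto simp: sandpile_def)
  obtain q2 where q2: "q2 \<le> a c" "right_stair a c (a c) q2" using stable_right_stair[OF st c(1)] by blast
  have "stable_config (mirror a)" using st by simp
  from stable_right_stair[OF this c(2)] obtain q1 where
    "q1 \<le> mirror a (1 - c)" "right_stair (mirror a) (1 - c) (mirror a (1 - c)) q1" by blast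
  then have q1: "q1 \<le> a (c - 1)" "left_stair a c (a (c - 1)) q1" by (simp_all add: left_stair_mirror mirror_def)
  define t u where "t = a (c - 1)" and "u = a c"
  note L = q1[folded t_def] and R = q2[folded u_def]
  have "int n = int (tri t + q1) + int (tri u + q2)"
    using cum_left_stair[OF fin tot L(2,1)] cum_right_stair[OF fin tot R(2,1)] by simp
  then have sum: "n = tri t + q1 + (tri u + q2)" by linarith
  have slope: "u \<le> t + 1" "t \<le> u + 1" using stable_slope[OF st, of "c - 1"] by (simp_all add: t_def u_def)
  \<comment> \<open>For \<open>u = t\<close> the total is \<open>t * t + t + q1 + q2\<close>, which
    reaches the next square exactly if \<open>q1 + q2 > t\<close>.\<close>
  consider "u = t + 1" | "u = t" "q1 + q2 \<le> t" | "u = t" "t < q1 + q2" | "t = u + 1" using slope by linarith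
  then show ?thesis
  proof cases
    case 1
    then have "n = (t + 1) * (t + 1) + (q1 + q2)" using sum two_tri[of t] tri_Suc[of t] by (simp add: algebra_simps)
    then have hr: "h = t + 1" "r = q1 + q2"
      using square_decomposition_unique[of h r "t + 1" "q1 + q2"] n L(1) R(1) 1 by auto
    then have "has_index h r a q1 c"
      using L R 1 by (auto simp: has_index_def right_part_def right_stair_def)
    then show ?thesis using L(1) hr(1) by (intro exI[of _ q1]) auto
  next
    case 2
    then have "n = t * t + (t + q1 + q2)" using sum two_tri[of t] by (simp add: algebra_simps)
    then have hr: "h = t" "r = t + q1 + q2"
      using square_decomposition_unique[of h r t "t + q1 + q2"] n 2 by auto
    show ?thesis
    proof (cases "q1 < t")
      case True
      then show ?thesis using has_index_plateau[of a c h q1 q2 r] L R hr 2 by auto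
    next
      case False
      then have q: "q1 = t" "q2 = 0" using L(1) 2 by auto
      then have "left_stair a (c - 1) t 0" "a (c - 1) = t" using left_stair_peel[OF L(2,1)] h hr(1) by auto
      moreover have "right_stair a (c - 1) t t"
        using right_stair_extend(2)[OF R(2)] 2 q calculation(2) by simp
      ultimately show ?thesis using has_index_plateau[of a "c - 1" h 0 h r] hr h q by auto
    qed
  next
    case 3
    then have "n = (t + 1) * (t + 1) + (q1 + q2 - (t + 1))" using sum two_tri[of t] by (simp add: algebra_simps)
    then have hr: "h = t + 1" "r = q1 + q2 - (t + 1)"
      using square_decomposition_unique[of h r "t + 1" "q1 + q2 - (t + 1)"] n L(1) R(1) 3 by auto
    have "has_index h r a q1 c"
      using L R 3 hr by (auto simp: has_index_def right_part_def right_stair_def)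
    then show ?thesis using L(1) hr(1) by (intro exI[of _ q1]) auto
  next
    case 4
    then have "n = t * t + (q1 + q2)" using sum two_tri[of u] tri_Suc[of u] by (simp add: algebra_simps)
    then have hr: "h = t" "r = q1 + q2"
      using square_decomposition_unique[of h r t "q1 + q2"] n L(1) R(1) 4 by auto
    have top: "a (c - 1) = u + 1" using 4 by (simp add: t_def)
    have R': "right_stair a (c - 1) h q2"
      using right_stair_extend(1)[OF R(2) top] R(1) hr(1) 4 by simp
    show ?thesis
    proof (cases "q1 < t")
      case True
      then have "has_index h r a q1 (c - 1)"
        using left_stair_peel(2)[OF L(2,1)] R' hr R(1) 4 by (auto simp: has_index_def right_part_def right_stair_def)
      then show ?thesis using True hr by blast
    next
      case False
      then have q: "q1 = t" using L(1) by simp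
      then have "left_stair a (c - 1) h 0" using left_stair_peel(3)[OF L(2,1)] h hr(1) by auto
      then show ?thesis using has_index_plateau[of a "c - 1" h 0 q2 r] R' hr h q R(1) 4 by auto
    qed
  qed
qed

text \<open>The heights around \<open>p\<close> put the partial sums at \<open>p - 2\<close> and
  \<open>p + 1\<close> outside the window for \<open>x\<close>. So \<open>e = p - 1\<close> and
  \<open>x = y\<close>, or \<open>e = p\<close> and \<open>x = y + a p \<le> h\<close>, which leaves
  \<open>y = 0\<close>, or \<open>y = 1\<close> with \<open>r = 0\<close>.\<close>

lemma index_from_cum:
  assumes fin: "finite {i. a i \<noteq> 0}" and tot: "\<exists>m. \<forall>i\<ge>m. cum a i = int n"
    and idx: "has_index h r a y p" "y < h" "r \<le> 2 * h" and h: "2 \<le> h"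
    and e: "cum a e = int (tri (h - 1) + x)" and x: "1 \<le> x" "x \<le> h"
  shows "x = y \<or> x = h \<and> (r = 0 \<or> y = 0)"
proof -
  have S: "cum a (p - 1) = int (tri (h - 1) + y)"
    using cum_left_stair[OF fin tot] idx by (simp add: has_index_def)
  have l: "a (p - 1) = h - 1"
    using idx left_stair_peel(1)[of a p "h - 1" y] h by (auto simp: has_index_def)
  have r: "a (p + int k) = right_part h r y k" for k using idx(1) by (simp add: has_index_def)
  have r0: "a p = (if r < y then h - 1 else h)" using r[of 0] idx by (auto simp: right_part_def stair_def)
  have r1: "1 \<le> a (p + 1)" using r[of 1] idx h by (auto simp: right_part_def stair_def) linarith
  have "p - 1 \<le> e"
  proof (rule ccontr)
    assume "\<not> p - 1 \<le> e"
    then have "cum a e \<le> cum a (p - 1 - 1)" by (intro cum_mono[OF fin]) simp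
    then show False using S l e x idx(2) cum_rec[OF fin, of "p - 1"] by simp
  qed
  moreover have "e \<le> p"
  proof (rule ccontr)
    assume "\<not> e \<le> p"
    then have "cum a (p + 1) \<le> cum a e" by (intro cum_mono[OF fin]) simp
    then show False
      using S r0 r1 e x idx(2) cum_rec[OF fin, of p] cum_rec[OF fin, of "p + 1"] by (auto split: if_splits)
  qed
  ultimately consider "e = p - 1" | "e = p" by linarith
  then show ?thesis
  proof cases
    case 2
    then show ?thesis using S r0 e x cum_rec[OF fin, of p] by (auto split: if_splits)
  qed (use S e in simp)
qed

section \<open>Forms and partial sums\<close>

lemma form_shift: "form (\<lambda>i. a (i + d)) = form a"
proof (cases "finite {i. a i \<noteq> 0}")
  case True
  let ?xs = "sorted_list_of_set {i. a i \<noteq> 0}"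
  have "sorted_list_of_set {i. a (i + d) \<noteq> 0} = map (\<lambda>i. i - d) ?xs"
  proof (rule sorted_distinct_set_unique)
    have img: "{i. a (i + d) \<noteq> 0} = (\<lambda>i. i - d) ` {i. a i \<noteq> 0}"
      by (auto intro!: image_eqI[where x = "_ + d"])
    then have fin: "finite {i. a (i + d) \<noteq> 0}" using True by simp
    show "set (sorted_list_of_set {i. a (i + d) \<noteq> 0}) = set (map (\<lambda>i. i - d) ?xs)"
      using img fin True by simp
    have "sorted_wrt (\<le>) ?xs" by simp
    then show "sorted (map (\<lambda>i. i - d) ?xs)" by (simp add: sorted_wrt_map)
    show "distinct (map (\<lambda>i. i - d) ?xs)" by (simp add: distinct_map inj_on_def)
  qed simp_all
  then show ?thesis by (simp add: form_def comp_def)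
next
  case False
  have "{i. a i \<noteq> 0} = (\<lambda>i. i + d) ` {i. a (i + d) \<noteq> 0}"
    by (auto intro!: image_eqI[where x = "_ - d"])
  then have "infinite {i. a (i + d) \<noteq> 0}" using False by (metis finite_imageI)
  then show ?thesis using False by (simp add: form_def sorted_list_of_set.fold_insort_key.infinite)
qed

lemma form_eq_of_index:
  assumes "has_index h r a x p" "has_index h r b x p'"
  shows "form a = form b"
proof -
  have r: "b (p' + int k) = a (p + int k)" and l: "b (p' - 1 - int k) = a (p - 1 - int k)" for k
    using assms by (simp_all add: has_index_def left_stair_def)
  have "b i = a (i + (p - p'))" for i
    using r[of "nat (i - p')"] l[of "nat (p' - 1 - i)"] by (cases "p' \<le> i") (simp_all add: algebra_simps)
  then have "b = (\<lambda>i. a (i + (p - p')))" by blast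
  then show ?thesis using form_shift by simp
qed

lemma cum_sorted_list:
  assumes "finite {i. a i \<noteq> 0}" "k < length (sorted_list_of_set {i. a i \<noteq> 0})"
  shows "cum a (sorted_list_of_set {i. a i \<noteq> 0} ! k) = int (sum_list (take (Suc k) (form a)))"
proof -
  let ?xs = "sorted_list_of_set {i. a i \<noteq> 0}"
  have "{j. j \<le> ?xs ! k \<and> a j \<noteq> 0} = set (take (Suc k) ?xs)"
  proof (intro equalityI subsetI)
    fix j assume j: "j \<in> {j. j \<le> ?xs ! k \<and> a j \<noteq> 0}"
    then have "j \<in> set ?xs" using assms(1) by simp
    then obtain l where l: "l < length ?xs" "?xs ! l = j" by (metis in_set_conv_nth)
    have "l \<le> k"
    proof (rule ccontr)
      assume "\<not> l \<le> k"
      then have "?xs ! k < ?xs ! l" using l(1) strict_sorted_list_of_set sorted_wrt_nth_less by (metis not_le)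
      then show False using l j by simp
    qed
    then show "j \<in> set (take (Suc k) ?xs)" using l by (auto simp: in_set_conv_nth intro!: exI[of _ l])
  next
    fix j assume "j \<in> set (take (Suc k) ?xs)"
    then obtain l where l: "l < Suc k" "l < length ?xs" "?xs ! l = j" by (auto simp: in_set_conv_nth)
    then have "j \<in> set ?xs" by auto
    moreover have "?xs ! l \<le> ?xs ! k" using l assms(2) by (intro sorted_nth_mono) auto
    ultimately show "j \<in> {j. j \<le> ?xs ! k \<and> a j \<noteq> 0}" using l assms(1) by simp
  qed
  then have "cum a (?xs ! k) = (\<Sum>j\<in>set (take (Suc k) ?xs). int (a j))" by (simp only: cum_def)
  also have "\<dots> = int (\<Sum>j\<in>set (take (Suc k) ?xs). a j)" by simp
  also have "(\<Sum>j\<in>set (take (Suc k) ?xs). a j) = sum_list (map a (take (Suc k) ?xs))"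
    by (simp add: sum_list_distinct_conv_sum_set)
  finally show ?thesis by (simp add: form_def take_map)
qed

text \<open>A positive partial sum is already attained at the last occupied column up to
  \<open>e\<close>, where it is a prefix sum of the form.\<close>

lemma cum_eq_of_form:
  assumes "finite {i. a i \<noteq> 0}" "finite {i. b i \<noteq> 0}" "form a = form b" "0 < cum a e"
  shows "\<exists>e'. cum b e' = cum a e"
proof -
  let ?X = "{j. j \<le> e \<and> a j \<noteq> 0}"
  have "?X \<noteq> {}" using assms(4) unfolding cum_def by (metis less_irrefl sum.empty)
  moreover have finX: "finite ?X" using assms(1) by (rule finite_subset[rotated]) auto
  ultimately have max: "Max ?X \<in> ?X" by (rule Max_in[rotated])
  define m where "m = Max ?X"
  have m: "m \<in> ?X" "\<And>j. j \<in> ?X \<Longrightarrow> j \<le> m" unfolding m_def by (rule max, rule Max_ge[OF finX])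
  have "j \<le> m \<and> a j \<noteq> 0 \<longleftrightarrow> j \<le> e \<and> a j \<noteq> 0" for j
    using m(1) m(2)[of j] by auto
  then have 1: "cum a m = cum a e" unfolding cum_def by presburger
  have "m \<in> set (sorted_list_of_set {i. a i \<noteq> 0})" using m(1) assms(1) by simp
  then obtain k where k: "k < length (sorted_list_of_set {i. a i \<noteq> 0})" "sorted_list_of_set {i. a i \<noteq> 0} ! k = m"
    by (metis in_set_conv_nth)
  have "length (form a) = length (form b)" using assms(3) by simp
  then have "k < length (sorted_list_of_set {i. b i \<noteq> 0})" using k(1) by (simp add: form_def)
  from cum_sorted_list[OF assms(2) this] cum_sorted_list[OF assms(1) k(1)] show ?thesis
    using assms(3) k(2) 1 by metis
qed

section \<open>Counting the forms\<close>

lemma floor_sqrt_decomposition: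
  obtains h r where "int h = \<lfloor>sqrt (real n)\<rfloor>" "n = h * h + r" "r \<le> 2 * h"
proof -
  define h where "h = nat \<lfloor>sqrt (real n)\<rfloor>"
  have h: "int h = \<lfloor>sqrt (real n)\<rfloor>" by (simp add: h_def)
  have "real h \<le> sqrt (real n)" using h by linarith
  then have "real h * real h \<le> sqrt (real n) * sqrt (real n)" by (intro mult_mono) auto
  then have "real (h * h) \<le> real n" by simp
  then have 1: "h * h \<le> n" by (simp only: of_nat_le_iff)
  have "sqrt (real n) < real h + 1" using h by linarith
  then have "sqrt (real n) * sqrt (real n) < (real h + 1) * (real h + 1)" by (intro mult_strict_mono) auto
  then have "real n < real ((h + 1) * (h + 1))" by (simp add: algebra_simps)
  then have "n < (h + 1) * (h + 1)" by (simp only: of_nat_less_iff)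
  then show ?thesis using that[OF h, of "n - h * h"] 1 by (simp add: algebra_simps)
qed

text \<open>A fixed point with partial sum \<open>tri (h - 1) + s\<close> has index \<open>s\<close>
  if \<open>1 \<le> s < h\<close>; for \<open>s = h\<close> and \<open>r \<noteq> 0\<close> it has
  index 0. Index 0 with \<open>r = 0\<close> is the pyramid.\<close>

lemma every_index_reached:
  assumes n: "n = h * h + r" "r \<le> 2 * h" and x: "x < h"
  shows "\<exists>f p. psspm_step\<^sup>*\<^sup>* (initial n) f \<and> stable_config f \<and> has_index h r f x p"
proof -
  have sp: "sandpile n f" if "psspm_step\<^sup>*\<^sup>* (initial n) f" for f
    using that sandpile_initial sandpile_psspm_steps by blast
  have idx: "\<exists>y<h. \<exists>p. has_index h r f y p" if "psspm_step\<^sup>*\<^sup>* (initial n) f" "stable_config f" for f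
    using stable_has_index[OF sp[OF that(1)] that(2) n] x by simp
  have partial: "\<exists>f y p. psspm_step\<^sup>*\<^sup>* (initial n) f \<and> stable_config f \<and> has_index h r f y p
      \<and> y < h \<and> (s = y \<or> s = h \<and> (r = 0 \<or> y = 0))" if s: "1 \<le> s" "s \<le> h" "2 \<le> h" for s
  proof -
    have "2 * (tri (h - 1) + s) \<le> 2 * n"
      using two_tri[of "h - 1"] s n by (cases h) (auto simp: algebra_simps)
    then obtain f e where f: "psspm_step\<^sup>*\<^sup>* (initial n) f" "stable_config f" "cum f e = int (tri (h - 1) + s)"
      using fixed_point_with_partial_sum[of "int (tri (h - 1) + s)" n] s by auto
    then obtain y p where y: "y < h" "has_index h r f y p" using idx by blast
    have "finite {i. f i \<noteq> 0}" "\<exists>m. \<forall>i\<ge>m. cum f i = int n" using sp[OF f(1)] by (auto simp: sandpile_def)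
    from index_from_cum[OF this y(2,1) n(2) s(3) f(3) s(1,2)] f y show ?thesis by blast
  qed
  consider "h = 1" | "2 \<le> h" "x \<noteq> 0" | "2 \<le> h" "x = 0" "r \<noteq> 0" | "2 \<le> h" "x = 0" "r = 0"
    using x by linarith
  then show ?thesis
  proof cases
    case 1
    obtain f where f: "psspm_step\<^sup>*\<^sup>* (initial n) f" "stable_config f"
      using fixed_point_exists[OF sandpile_initial] by blast
    then obtain y p where "y < h" "has_index h r f y p" using idx by blast
    with f 1 x show ?thesis by auto
  next
    case 2
    then show ?thesis using partial[of x] x by auto
  next
    case 3
    then show ?thesis using partial[of h] by auto
  next
    case 4
    then obtain f where f: "psspm_step\<^sup>*\<^sup>* (initial n) f" "stable_config f" "h \<le> f 0"
      using square_fixed_point[of n h] n by auto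
    then obtain y p where y: "y < h" "has_index h r f y p" using idx by blast
    \<comment> \<open>For \<open>r = 0 < y\<close> both parts have top \<open>h - 1\<close>, against
      \<open>f 0 \<ge> h\<close>.\<close>
    have "y = 0"
    proof (rule ccontr)
      assume "y \<noteq> 0"
      have "f i \<le> h - 1" for i
      proof (cases "p \<le> i")
        case True
        have "f (p + int k) = stair (h - 1) (h - y) k" for k
          using y(2) \<open>y \<noteq> 0\<close> 4(3) by (simp add: has_index_def right_part_def)
        then have "f (p + int (nat (i - p))) = stair (h - 1) (h - y) (nat (i - p))" .
        also have "\<dots> \<le> h - 1" using \<open>y \<noteq> 0\<close> by (intro stair_le) simp
        finally show ?thesis using True by simp
      next
        case False
        have "f (p - 1 - int k) = stair (h - 1) y k" for k
          using y(2) by (simp add: has_index_def left_stair_def)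
        then have "f (p - 1 - int (nat (p - 1 - i))) = stair (h - 1) y (nat (p - 1 - i))" .
        also have "\<dots> \<le> h - 1" using y(1) by (intro stair_le) simp
        finally show ?thesis using False by simp
      qed
      from this[of 0] show False using f(3) x by simp
    qed
    with f y 4 show ?thesis by blast
  qed
qed

text \<open>For \<open>x > 0\<close> the partial sum \<open>tri (h - 1) + x\<close> of
  \<open>f\<close> also occurs in \<open>g\<close>, which forces index \<open>x\<close> since
  \<open>x < h\<close>. The case \<open>x = 0\<close> is settled by symmetry.\<close>

lemma index_unique_of_form:
  assumes n: "n = h * h + r" "r \<le> 2 * h"
    and f: "sandpile n f" "has_index h r f x p" "x < h" and g: "sandpile n g" "has_index h r g y p'" "y < h"
    and "form f = form g"
  shows "x = y"
proof -
  have le: "x \<le> y"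
    if f: "sandpile n f" "has_index h r f x p" "x < h" and g: "sandpile n g" "has_index h r g y p'" "y < h"
      and form: "form f = form g" for f g x y p p'
  proof (cases "x = 0")
    case False
    have fin: "finite {i. f i \<noteq> 0}" "finite {i. g i \<noteq> 0}"
      and tot: "\<exists>m. \<forall>i\<ge>m. cum f i = int n" "\<exists>m. \<forall>i\<ge>m. cum g i = int n"
      using f(1) g(1) by (auto simp: sandpile_def)
    have c: "cum f (p - 1) = int (tri (h - 1) + x)"
      using cum_left_stair[OF fin(1) tot(1)] f(2,3) by (simp add: has_index_def)
    obtain e where "cum g e = int (tri (h - 1) + x)"
      using cum_eq_of_form[OF fin form, of "p - 1"] c False by auto
    from index_from_cum[OF fin(2) tot(2) g(2,3) n(2) _ this] False f(3) show ?thesis by auto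
  qed simp
  show ?thesis using le[OF f g] le[OF g f] assms(9) by simp
qed

theorem theorem5:
  fixes n :: nat
  assumes "n > 0"
  shows "fixed_point_forms (PSSPM n) = fixed_point_forms (SSPM n)
       \<and> int (card (fixed_point_forms (PSSPM n))) = \<lfloor>sqrt (real n)\<rfloor>"
proof -
  obtain h r where h: "int h = \<lfloor>sqrt (real n)\<rfloor>" and n: "n = h * h + r" "r \<le> 2 * h"
    using floor_sqrt_decomposition .
  have "0 < h" using assms n by (cases h) auto
  obtain g p where g: "\<And>x. x < h \<Longrightarrow> psspm_step\<^sup>*\<^sup>* (initial n) (g x) \<and> stable_config (g x) \<and> has_index h r (g x) x (p x)"
    using every_index_reached[OF n] by metis
  have P: "fixed_points (PSSPM n) \<subseteq> fixed_points (SSPM n)"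
    using psspm_steps_simulation[OF _ sandpile_initial] by (auto simp: fixed_points_def PSSPM_def SSPM_def)
  have S: "form f \<in> (\<lambda>x. form (g x)) ` {..<h}" if "f \<in> fixed_points (SSPM n)" for f
  proof -
    have "sandpile n f" "stable_config f"
      using that sandpile_sspm_steps[OF _ sandpile_initial]
      by (auto simp: fixed_points_def SSPM_def stable_config_def)
    then obtain x q where x: "x < h" "has_index h r f x q" using stable_has_index n \<open>0 < h\<close> by blast
    then have "form f = form (g x)" using form_eq_of_index g by blast
    then show ?thesis using x(1) by blast
  qed
  have G: "(\<lambda>x. form (g x)) ` {..<h} \<subseteq> fixed_point_forms (PSSPM n)"
    using g by (auto simp: fixed_point_forms_def fixed_points_def PSSPM_def stable_config_def)
  \<comment> \<open>The inclusions close a circle from the parallel forms through the sequential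
    ones to the forms of the \<open>g x\<close> and back.\<close>
  have forms: "fixed_point_forms (PSSPM n) = (\<lambda>x. form (g x)) ` {..<h}"
    "fixed_point_forms (SSPM n) = (\<lambda>x. form (g x)) ` {..<h}"
    using P S G unfolding fixed_point_forms_def by blast+
  have "inj_on (\<lambda>x. form (g x)) {..<h}"
  proof (rule inj_onI)
    fix x y assume xy: "x \<in> {..<h}" "y \<in> {..<h}" "form (g x) = form (g y)"
    have "sandpile n (g x)" "sandpile n (g y)"
      using g xy sandpile_psspm_steps[OF _ sandpile_initial] by auto
    then show "x = y" using index_unique_of_form[OF n _ _ _ _ _ _ xy(3)] g xy by blast
  qed
  then have "card (fixed_point_forms (PSSPM n)) = h"
    unfolding forms by (simp add: card_image)
  then show ?thesis using forms h by simp
qed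

end
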